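(* Let $B$ be a Boolean $\sigma$-algebra. Then $B$ is a measure algebra if and only if $B$ is uniformly weakly distributive and concentrated.
   Context: A Boolean algebra $B$ is an algebra of subsets of a nonempty set $X$ with operations $a\cup b$, $a\cap b$, $-a=X-a$, zero $\mathbf 0=\emptyset$ and unit $\mathbf 1=X$ (so $\mathbf 0\neq\mathbf 1$), ordered by inclusion. $B$ is a Boolean $\sigma$-algebra if every countable $A\subset B$ has a supremum $\bigvee A$ and an infimum $\bigwedge A$ in the ordering of $B$. $B^+=B-\{\mathbf 0\}$. A measure on a Boolean $\sigma$-algebra $B$ is a real-valued function $m$ on $B$ with: $m(\mathbf 0)=0$, $m(a)>0$ for $a\ne\mathbf 0$, $m(\mathbf 1)=1$; $m(a)\le m(b)$ if $a\subset b$; $m(a\cup b)=m(a)+m(b)$ if $a\cap b=\mathbf 0$; and $m(\bigvee_{n=1}^\infty a_n)=\sum_{n=1}^\infty m(a_n)$ whenever the $a_n$ are pairwise disjoint. A measure algebra is a Boolean $\sigma$-algebra that carries a measure. An antichain is a set $A\subset B^+$ such that $a\cap b=\mathbf 0$ for all distinct $a,b\in A$. A partition (of $\mathbf 1$) is a maximal antichain, i.e. an antichain with supremum $\mathbf 1$. For a sequence $\{a_n\}_n$ in a Boolean $\sigma$-algebra, $\limsup_n a_n=\bigwedge_{n=1}^\infty\bigvee_{k=n}^\infty a_k$ and $\liminf_n a_n=\bigvee_{n=1}^\infty\bigwedge_{k=n}^\infty a_k$; $\lim_n a_n=a$ means $\limsup_n a_n=\liminf_n a_n=a$. For a finite $E\subset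 B$, $\bigcup E$ denotes the join of the elements of $E$. $B$ is uniformly weakly distributive if there is a sequence of functions $\{F_n\}_{n=1}^\infty$ such that for each partition $W$, $F_n(W)$ is a finite subset of $W$, and if $\{W_n\}_{n=1}^\infty$ is a sequence of countable partitions then $\lim_n\bigcup F_n(W_n)=\mathbf 1$. $B$ is concentrated if for every sequence $\{A_n\}_{n=1}^\infty$ of finite antichains with $|A_n|\ge 2^n$ for each $n$ there exist $a_n\in A_n$ such that $\lim_n a_n=\mathbf 0$. *)

theory Defs
  imports "HOL-Analysis.Analysis" "HOL-Library.Lub_Glb"
begin

text \<open>
  A Boolean algebra is an algebra \<open>B\<close> of subsets of a nonempty set \<open>X\<close> (library locale
  \<^locale>\<open>algebra\<close>), with zero \<open>{}\<close> and unit \<open>X\<close>. Suprema and infima are taken in the poset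
  \<open>(B, \<subseteq>)\<close>; a supremum of an infinite family need not be its union, since the union may lie
  outside \<open>B\<close>. All sequences except in \<open>is_measure\<close> are used only at
  indices \<open>n \<ge> 1\<close>.
\<close>

definition boolean_sigma_algebra :: "'a set \<Rightarrow> 'a set set \<Rightarrow> bool" where
  "boolean_sigma_algebra X B \<longleftrightarrow>
     X \<noteq> {} \<and> algebra X B \<and>
     (\<forall>A. A \<subseteq> B \<longrightarrow> countable A \<longrightarrow> (\<exists>s. isLub B A s) \<and> (\<exists>i. isGlb B A i))"

definition bsup :: "'a set set \<Rightarrow> 'a set set \<Rightarrow> 'a set" where
  "bsup B A = (THE s. isLub B A s)"

definition binf :: "'a set set \<Rightarrow> 'a set set \<Rightarrow> 'a set" where
  "binf B A = (THE i. isGlb B A i)"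

lemma bsup_eqI:
  assumes "isLub B A s"
  shows "bsup B A = s"
proof -
  have "t = s" if "isLub B A t" for t
    using isLub_le_isUb[OF that isLub_isUb[OF assms]]
      isLub_le_isUb[OF assms isLub_isUb[OF that]] by (rule subset_antisym)
  with assms show ?thesis unfolding bsup_def by (rule the_equality)
qed

lemma binf_eqI:
  assumes "isGlb B A i"
  shows "binf B A = i"
proof -
  have "t = i" if "isGlb B A t" for t
    using isGlb_le_isLb[OF assms isGlb_isLb[OF that]]
      isGlb_le_isLb[OF that isGlb_isLb[OF assms]] by (rule subset_antisym)
  with assms show ?thesis unfolding binf_def by (rule the_equality)
qed

definition is_measure :: "'a set \<Rightarrow> 'a set set \<Rightarrow> ('a set \<Rightarrow> real) \<Rightarrow> bool" where
  "is_measure X B m \<longleftrightarrow>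
     m {} = 0 \<and> (\<forall>a\<in>B. a \<noteq> {} \<longrightarrow> m a > 0) \<and> m X = 1 \<and>
     (\<forall>a\<in>B. \<forall>b\<in>B. a \<subseteq> b \<longrightarrow> m a \<le> m b) \<and>
     (\<forall>a\<in>B. \<forall>b\<in>B. a \<inter> b = {} \<longrightarrow> m (a \<union> b) = m a + m b) \<and>
     (\<forall>a :: nat \<Rightarrow> 'a set. range a \<subseteq> B \<longrightarrow> disjoint_family a \<longrightarrow>
        (\<lambda>n. m (a n)) sums m (bsup B (range a)))"

definition measure_algebra :: "'a set \<Rightarrow> 'a set set \<Rightarrow> bool" where
  "measure_algebra X B \<longleftrightarrow> boolean_sigma_algebra X B \<and> (\<exists>m. is_measure X B m)"

definition antichain :: "'a set set \<Rightarrow> 'a set set \<Rightarrow> bool" where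
  "antichain B A \<longleftrightarrow> A \<subseteq> B - {{}} \<and> (\<forall>a\<in>A. \<forall>b\<in>A. a \<noteq> b \<longrightarrow> a \<inter> b = {})"

definition partition :: "'a set set \<Rightarrow> 'a set set \<Rightarrow> bool" where
  "partition B W \<longleftrightarrow> antichain B W \<and> (\<forall>A. antichain B A \<longrightarrow> W \<subseteq> A \<longrightarrow> A = W)"

lemma isLub_space_iff:
  assumes "algebra X B" "W \<subseteq> B"
  shows "isLub B W X \<longleftrightarrow> (\<forall>u\<in>B. (\<forall>w\<in>W. w \<subseteq> u) \<longrightarrow> X \<subseteq> u)"
proof -
  interpret algebra X B by fact
  have "\<forall>w\<in>W. w \<subseteq> X" using assms(2) sets_into_space by auto
  then show ?thesis
    by (simp add: isLub_def leastP_def setge_def isUb_def setle_def Ball_def conj_commute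
        imp_conjL)
qed

lemma partition_iff_isLub:
  assumes "algebra X B"
  shows "partition B W \<longleftrightarrow> antichain B W \<and> isLub B W X"
proof (intro iffI conjI)
  interpret algebra X B by fact
  assume P: "partition B W"
  then show W: "antichain B W" by (simp add: partition_def)
  then have WB: "W \<subseteq> B" by (auto simp: antichain_def)
  have "X \<subseteq> u" if u: "u \<in> B" and le: "\<forall>w\<in>W. w \<subseteq> u" for u
  proof (rule ccontr)
    assume "\<not> X \<subseteq> u"
    then have ne: "X - u \<noteq> {}" by blast
    have "X - u \<in> B" using u by (rule compl_sets)
    moreover have "(X - u) \<inter> w = {}" "w \<inter> (X - u) = {}" if "w \<in> W" for w
      using le that by auto
    ultimately have "antichain B (insert (X - u) W)"
      using W ne by (simp add: antichain_def)
    then have "insert (X - u) W = W"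
      using P unfolding partition_def by (simp add: subset_insertI)
    then have "X - u \<in> W" by (metis insertI1)
    then have "X - u \<subseteq> u" using le by simp
    then show False using ne by blast
  qed
  then show "isLub B W X" using isLub_space_iff[OF assms WB] by simp
next
  interpret algebra X B by fact
  assume *: "antichain B W \<and> isLub B W X"
  then have W: "antichain B W" and sup: "isLub B W X" by auto
  have WB: "W \<subseteq> B" using W by (auto simp: antichain_def)
  have "A = W" if A: "antichain B A" and sub: "W \<subseteq> A" for A
  proof (rule ccontr)
    assume "A \<noteq> W"
    then obtain c where c: "c \<in> A" "c \<notin> W" using sub by blast
    have cB: "c \<in> B" "c \<noteq> {}" using c A by (auto simp: antichain_def)
    have "w \<subseteq> X - c" if "w \<in> W" for w
    proof -
      have "w \<in> A" "w \<noteq> c" using that sub c by auto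
      then have "w \<inter> c = {}" using A c by (simp add: antichain_def)
      moreover have "w \<subseteq> X" using that WB sets_into_space by blast
      ultimately show ?thesis by blast
    qed
    moreover have "X - c \<in> B" using cB(1) by (rule compl_sets)
    ultimately have "X \<subseteq> X - c" using sup isLub_space_iff[OF assms WB] by simp
    moreover have "c \<subseteq> X" using cB sets_into_space by blast
    ultimately show False using cB by blast
  qed
  then show "partition B W" using W by (simp add: partition_def)
qed

definition blimsup :: "'a set set \<Rightarrow> (nat \<Rightarrow> 'a set) \<Rightarrow> 'a set" where
  "blimsup B a = binf B ((\<lambda>n. bsup B (a ` {n..})) ` {1..})"

definition bliminf :: "'a set set \<Rightarrow> (nat \<Rightarrow> 'a set) \<Rightarrow> 'a set" where
  "bliminf B a = bsup B ((\<lambda>n. binf B (a ` {n..})) ` {1..})"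

definition blim :: "'a set set \<Rightarrow> (nat \<Rightarrow> 'a set) \<Rightarrow> 'a set \<Rightarrow> bool" where
  "blim B a l \<longleftrightarrow> blimsup B a = l \<and> bliminf B a = l"

text \<open>The join of a finite subset of \<open>B\<close> is its union, which lies in \<open>B\<close>.\<close>

definition uniformly_weakly_distributive :: "'a set \<Rightarrow> 'a set set \<Rightarrow> bool" where
  "uniformly_weakly_distributive X B \<longleftrightarrow>
     (\<exists>F :: nat \<Rightarrow> 'a set set \<Rightarrow> 'a set set.
        (\<forall>n\<ge>1. \<forall>W. partition B W \<longrightarrow> finite (F n W) \<and> F n W \<subseteq> W) \<and>
        (\<forall>W :: nat \<Rightarrow> 'a set set.
           (\<forall>n\<ge>1. partition B (W n) \<and> countable (W n)) \<longrightarrow>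
           blim B (\<lambda>n. \<Union> (F n (W n))) X))"

definition concentrated :: "'a set set \<Rightarrow> bool" where
  "concentrated B \<longleftrightarrow>
     (\<forall>A :: nat \<Rightarrow> 'a set set.
        (\<forall>n\<ge>1. antichain B (A n) \<and> finite (A n) \<and> card (A n) \<ge> 2 ^ n) \<longrightarrow>
        (\<exists>a. (\<forall>n\<ge>1. a n \<in> A n) \<and> blim B a {}))"

end

theory Submission
  imports Defs "HOL-Library.Function_Algebras"
begin

text \<open>
  Forwards, both conditions follow from the Borel-Cantelli lemma. Backwards, let \<open>S k\<close> consist of
  the elements disjoint from \<open>\<Union>(F k W)\<close> for some countable partition \<open>W\<close>. Uniform weak
  distributivity makes \<open>S\<close> behave like a countable base of neighbourhoods of zero for
  order-convergent sequences, and concentration bounds the size of the antichains that avoid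
  \<open>S k\<close>. The Kalton-Roberts argument with bipartite expander graphs then gives the complement of
  every \<open>S k\<close> a positive intersection number, and Kelley's argument (Hahn-Banach) a finitely
  additive probability bounded away from zero there. A weighted sum of these is strictly positive;
  its countably additive part is still strictly positive by weak distributivity.
\<close>

section \<open>Expander graphs\<close>

text \<open>Expander arguments of this kind usually run on a submeasure. None is available here, and
  order convergence is not known to come from a metric. What remains of a metric are the two laws of
  \<open>null_base\<close>: every choice \<open>a n \<in> S n\<close> is null, and every null
  sequence in \<open>B\<close> eventually lies in each \<open>S k\<close>. Diagonal arguments from
  these laws replace the quantitative ones; in particular \<open>S_union\<close> is a weak triangle
  inequality. It is applied twice in a row, because an expander of left degree 4 cuts an element
  into 4 pieces. Finite and infinite operations are kept apart. Counting the points of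
  \<open>X\<close> that lie in given elements is sound only for finite Boolean combinations, since a
  supremum in \<open>B\<close> need not be a union. So the combinatorics stays finite and can
  produce only finitely additive charges; everything infinite goes through \<open>null_seq\<close>.
  The missing countable additivity is restored at the end, and keeping strict positivity in that
  step requires the laws of \<open>S\<close> a second time.\<close>

lemma power_self_le_pow3_fact: "real n ^ n \<le> 3 ^ n * fact n"
proof -
  \<comment> \<open>The left side is a single term of the exponential series at \<open>n\<close>.
    Together with \<open>exp 1 \<le> 3\<close> this is the crude half of Stirling's formula, enough
    for the binomial estimate.\<close>
  have "real n ^ n / fact n \<le> exp (real n)"
  proof -
    have "(\<Sum>k\<in>{n}. real n ^ k /\<^sub>R fact k) \<le> (\<Sum>k. real n ^ k /\<^sub>R fact k)"
      by (rule sum_le_suminf[OF summable_exp_generic]) auto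
    then show ?thesis by (simp add: exp_def divide_inverse mult.commute)
  qed
  also have "exp (real n) = exp 1 ^ n" by (simp add: exp_of_nat_mult[symmetric])
  also have "\<dots> \<le> 3 ^ n" by (rule power_mono[OF exp_le]) simp
  finally show ?thesis by (simp add: divide_simps)
qed

lemma binomial_le_pow3:
  assumes "k > 0"
  shows "real (n choose k) \<le> (3 * real n / real k) ^ k"
proof -
  have "real (n choose k) * real k ^ k \<le> real (n choose k) * (3 ^ k * fact k)"
    by (intro mult_left_mono power_self_le_pow3_fact) simp
  also have "\<dots> = 3 ^ k * real ((n choose k) * fact k)" by simp
  also have "\<dots> \<le> 3 ^ k * real (n ^ k)"
    by (intro mult_left_mono of_nat_mono binomial_fact_pow) simp
  finally show ?thesis using assms by (simp add: power_divide power_mult_distrib divide_simps)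
qed

text \<open>One summand of the union bound: choices of a left set of size \<open>e\<close>, choices
  of a target of size \<open>2 * e\<close>, and the probability that all \<open>4 * e\<close> values
  land in the target. With \<open>3 * n / k\<close> bounding the binomials, everything is an
  \<open>e\<close>-th power with base \<open>108 * m * e / l^2\<close>; the constant 216 brings that
  base down to \<open>1/2\<close>.\<close>

lemma expander_count:
  assumes "e > 0" "l > 0" "216 * m * e \<le> l\<^sup>2"
  shows "real (m choose e) * real (l choose (2*e)) * (real (2*e) / real l) ^ (4*e) \<le> (1/2) ^ e"
proof -
  have "real (m choose e) * real (l choose (2*e)) * (real (2*e) / real l) ^ (4*e)
    \<le> (3 * real m / real e) ^ e * (3 * real l / real (2*e)) ^ (2*e) * (real (2*e) / real l) ^ (4*e)"
    using assms by (intro mult_right_mono mult_mono binomial_le_pow3) auto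
  also have "\<dots> = ((3 * real m / real e) * (3 * real l / real (2*e))\<^sup>2 * (real (2*e) / real l) ^ 4) ^ e"
    by (simp only: power_mult power_mult_distrib)
  also have "(3 * real m / real e) * (3 * real l / real (2*e))\<^sup>2 * (real (2*e) / real l) ^ 4
     = 108 * real m * real e / (real l)\<^sup>2"
    using assms by (simp add: field_simps power2_eq_square power4_eq_xxxx)
  also have "\<dots> ^ e \<le> (1/2) ^ e"
  proof (rule power_mono)
    have "real (216 * m * e) \<le> real (l\<^sup>2)" using assms(3) of_nat_mono by blast
    then show "108 * real m * real e / (real l)\<^sup>2 \<le> 1/2" using assms(2) by (simp add: field_simps)
  qed simp
  finally show ?thesis .
qed

text \<open>By counting: the proportion of maps that send some \<open>E \<times> {..<4}\<close> with \<open>card E = e\<close> into a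
  set of size \<open>2 * e\<close> is at most the sum of \<open>(1/2) ^ e\<close>, which is less than 1.\<close>

lemma ex_expander:
  fixes m l :: nat
  assumes l: "l > 0" and lm: "l \<le> m"
  obtains R :: "nat \<times> nat \<Rightarrow> nat" where
    "\<And>i j. i < m \<Longrightarrow> j < 4 \<Longrightarrow> R (i, j) < l"
    "\<And>E. E \<subseteq> {..<m} \<Longrightarrow> E \<noteq> {} \<Longrightarrow> 216 * m * card E \<le> l\<^sup>2 \<Longrightarrow>
      2 * card E < card (R ` (E \<times> {..<4}))"
proof -
  define T where "T = ({..<m} \<times> {..<4::nat}) \<rightarrow>\<^sub>E {..<l}"
  define K where "K = {e. 0 < e \<and> 216 * m * e \<le> l\<^sup>2}"
  define bad where "bad E F = {R \<in> T. R ` (E \<times> {..<4}) \<subseteq> F}" for E F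
  define subs where "subs n k = {E. E \<subseteq> {..<n::nat} \<and> card E = k}" for n k :: nat
  have m: "m > 0" using l lm by simp
  \<comment> \<open>Targets of size \<open>2 * e\<close> must fit among the \<open>l\<close> right
    vertices: \<open>216 * m * e \<le> l * l \<le> m * l\<close> cancels to
    \<open>216 * e \<le> l\<close>. The same bound makes \<open>K\<close> finite.\<close>
  have K_small: "2 * e \<le> l" if "e \<in> K" for e
  proof -
    have "216 * m * e \<le> l * l" using that by (simp add: K_def power2_eq_square)
    also have "\<dots> \<le> m * l" using lm by simp
    finally have "m * (216 * e) \<le> m * l" by (simp only: ac_simps)
    then have "216 * e \<le> l" using m by (simp only: mult_le_cancel1)
    then show ?thesis by simp
  qed
  have K_fin: "finite K" by (rule finite_subset[of _ "{..l}"]) (auto dest: K_small)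
  have T_fin: "finite T" by (simp add: T_def finite_PiE)
  have T_card: "card T = l ^ (4 * m)" by (simp add: T_def card_PiE mult.commute)
  have subs_fin: "finite (subs n k)" for n k by (simp add: subs_def)
  have subs_card: "card (subs n k) = n choose k" for n k by (simp add: subs_def n_subsets)
  have bad_fin: "finite (bad E F)" for E F using T_fin by (simp add: bad_def)
  have bad_card: "real (card (bad E F)) = (real (2*e) / real l) ^ (4*e) * real l ^ (4*m)"
    if E: "E \<in> subs m e" and F: "F \<in> subs l (2*e)" for E F e
  proof -
    have E': "E \<subseteq> {..<m}" "card E = e" "finite E" and F': "F \<subseteq> {..<l}" "card F = 2*e"
      using E F finite_subset by (auto simp: subs_def)
    have em: "e \<le> m" using card_mono[OF _ E'(1)] E' by simp
    \<comment> \<open>The bad maps again form a product, with factor \<open>F\<close> over the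
      coordinates in \<open>E\<close> and \<open>{..<l}\<close> elsewhere, so they can be counted
      exactly.\<close>
    have "bad E F = PiE ({..<m} \<times> {..<4}) (\<lambda>z. if z \<in> E \<times> {..<4} then F else {..<l})" (is "_ = ?P")
    proof (intro set_eqI iffI)
      fix R assume "R \<in> bad E F"
      then show "R \<in> ?P" by (auto simp: bad_def T_def PiE_iff)
    next
      fix R assume R: "R \<in> ?P"
      have "R z \<in> {..<l}" if "z \<in> {..<m} \<times> {..<4}" for z
        using PiE_mem[OF R that] F' by (auto split: if_splits)
      moreover have "R z \<in> F" if "z \<in> E \<times> {..<4}" for z
        using PiE_mem[OF R, of z] that E' by auto
      moreover have "R \<in> extensional ({..<m} \<times> {..<4})" using R by (simp add: PiE_iff)
      ultimately show "R \<in> bad E F" by (auto simp: bad_def T_def PiE_iff)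
    qed
    then have "card (bad E F) = (\<Prod>z\<in>{..<m} \<times> {..<4::nat}. card (if z \<in> E \<times> {..<4} then F else {..<l}))"
      by (simp add: card_PiE)
    also have "\<dots> = (\<Prod>z\<in>{..<m} \<times> {..<4::nat}. if z \<in> E \<times> {..<4} then 2*e else l)"
      by (rule prod.cong) (auto simp: F')
    also have "\<dots> = (\<Prod>z\<in>E \<times> {..<4::nat}. 2*e) * (\<Prod>z\<in>({..<m} - E) \<times> {..<4::nat}. l)"
    proof -
      have *: "{..<m} \<times> {..<4} \<inter> {z. z \<in> E \<times> {..<4::nat}} = E \<times> {..<4}"
        "{..<m} \<times> {..<4} \<inter> - {z. z \<in> E \<times> {..<4::nat}} = ({..<m} - E) \<times> {..<4}"
        using E' by auto
      show ?thesis by (subst prod.If_cases) (use * in auto)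
    qed
    also have "\<dots> = (2*e) ^ (4*e) * l ^ (4 * (m - e))"
      using E' by (simp add: card_Diff_subset mult.commute)
    finally have "real (card (bad E F)) = real (2*e) ^ (4*e) * real l ^ (4 * (m - e))" by simp
    moreover have "real l ^ (4*m) = real l ^ (4*e) * real l ^ (4 * (m - e))"
      using em by (simp add: power_add[symmetric] algebra_simps)
    ultimately show ?thesis using l by (simp add: power_divide)
  qed
  define Bad where "Bad = (\<Union>e\<in>K. \<Union>E\<in>subs m e. \<Union>F\<in>subs l (2*e). bad E F)"
  have "real (card Bad) \<le> (\<Sum>e\<in>K. \<Sum>E\<in>subs m e. \<Sum>F\<in>subs l (2*e). real (card (bad E F)))"
  proof -
    have "card Bad \<le> (\<Sum>e\<in>K. \<Sum>E\<in>subs m e. \<Sum>F\<in>subs l (2*e). card (bad E F))"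
      unfolding Bad_def
      by (intro order_trans[OF card_UN_le] sum_mono K_fin subs_fin order_refl)
    then show ?thesis by (simp flip: of_nat_sum)
  qed
  also have "\<dots> = (\<Sum>e\<in>K. real (m choose e) * real (l choose (2*e)) *
      (real (2*e) / real l) ^ (4*e) * real l ^ (4*m))"
    by (rule sum.cong) (simp_all add: bad_card subs_card)
  also have "\<dots> \<le> (\<Sum>e\<in>K. (1/2) ^ e * real l ^ (4*m))"
    by (intro sum_mono mult_right_mono expander_count) (auto simp: K_def l)
  also have "\<dots> = (\<Sum>e\<in>K. (1/2) ^ e) * real l ^ (4*m)" by (simp add: sum_distrib_right)
  also have "\<dots> < 1 * real l ^ (4*m)"
  proof (rule mult_strict_right_mono)
    have "(\<Sum>e\<in>K. (1/2::real) ^ e) \<le> (\<Sum>e=1..l. (1/2) ^ e)"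
    proof (rule sum_mono2)
      show "K \<subseteq> {1..l}"
      proof
        fix e assume e: "e \<in> K"
        from K_small[OF this] have "e \<le> l" by simp
        then show "e \<in> {1..l}" using e by (simp add: K_def)
      qed
    qed simp_all
    also have "\<dots> = 1 - (1/2) ^ l" by (induction l) auto
    also have "\<dots> < 1" by simp
    finally show "(\<Sum>e\<in>K. (1/2::real) ^ e) < 1" .
  qed (simp add: l)
  also have "\<dots> = real (card T)" by (simp add: T_card)
  finally have "card Bad < card T" by simp
  moreover have "finite Bad" unfolding Bad_def by (intro finite_UN_I K_fin subs_fin bad_fin)
  ultimately have "\<not> T \<subseteq> Bad" using card_mono[of Bad T] by linarith
  then obtain R where R: "R \<in> T" "R \<notin> Bad" by blast
  show thesis
  proof (rule that[of R])
    fix i j assume "i < m" "j < (4::nat)"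
    then show "R (i, j) < l" using R(1) by (auto simp: T_def PiE_iff)
  next
    fix E assume E: "E \<subseteq> {..<m}" "E \<noteq> {}" "216 * m * card E \<le> l\<^sup>2"
    have fin: "finite E" using E(1) finite_subset by blast
    then have K: "card E \<in> K" using E by (simp add: K_def card_gt_0_iff)
    show "2 * card E < card (R ` (E \<times> {..<4}))"
    proof (rule ccontr)
      assume "\<not> ?thesis"
      then have le: "card (R ` (E \<times> {..<4})) \<le> 2 * card E" by simp
      have sub: "R ` (E \<times> {..<4}) \<subseteq> {..<l}" using R(1) E(1) by (auto simp: T_def PiE_iff)
      \<comment> \<open>Only targets of exactly \<open>2 * card E\<close> elements were counted, so
        a smaller image is padded to that size.\<close>
      obtain F where "R ` (E \<times> {..<4}) \<subseteq> F" "F \<subseteq> {..<l}" "card F = 2 * card E"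
        using exists_subset_between[OF le _ sub] K_small[OF K] by auto
      then have "R \<in> Bad" using K E(1) R(1)
        unfolding Bad_def bad_def subs_def by blast
      then show False using R(2) by simp
    qed
  qed
qed

text \<open>Since every left vertex has degree at most 4, the expansion forces a right vertex with a
  single neighbour; match the two and remove them.\<close>

lemma expander_matching:
  fixes R :: "'i \<times> nat \<Rightarrow> 'y"
  assumes "finite E"
    and "\<And>E'. E' \<subseteq> E \<Longrightarrow> E' \<noteq> {} \<Longrightarrow> 2 * card E' < card (R ` (E' \<times> {..<4}))"
  shows "\<exists>f. inj_on f E \<and> (\<forall>i\<in>E. f i \<in> R ` ({i} \<times> {..<4}))"
  using assms
proof (induction "card E" arbitrary: E)
  case 0
  then show ?case by simp
next
  case (Suc n)
  define N where "N = R ` (E \<times> {..<4})"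
  define deg where "deg y = {i \<in> E. y \<in> R ` ({i} \<times> {..<4})}" for y
  have fin: "finite E" by fact
  have finN: "finite N" by (simp add: N_def fin)
  have E: "E \<noteq> {}" using Suc.hyps(2) by auto
  have "(\<Sum>y\<in>N. card (deg y)) = (\<Sum>i\<in>E. card {y \<in> N. y \<in> R ` ({i} \<times> {..<4})})"
    unfolding deg_def by (rule sum_multicount_gen) (auto simp: fin finN)
  also have "\<dots> \<le> (\<Sum>i\<in>E. 4)"
  proof (rule sum_mono)
    fix i assume "i \<in> E"
    have "card {y \<in> N. y \<in> R ` ({i} \<times> {..<4})} \<le> card (R ` ({i} \<times> {..<4}))"
      by (rule card_mono) auto
    also have "\<dots> \<le> card ({i} \<times> {..<4::nat})" by (rule card_image_le) simp
    finally show "card {y \<in> N. y \<in> R ` ({i} \<times> {..<4})} \<le> 4" by simp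
  qed
  finally have deg_sum: "(\<Sum>y\<in>N. card (deg y)) \<le> 4 * card E" by simp
  \<comment> \<open>At most \<open>4 * card E\<close> incidences are spread over more than
    \<open>2 * card E\<close> right vertices.\<close>
  have "\<exists>y\<in>N. card (deg y) < 2"
  proof (rule ccontr)
    assume "\<not> ?thesis"
    then have "(\<Sum>y\<in>N. 2) \<le> (\<Sum>y\<in>N. card (deg y))" by (intro sum_mono) auto
    moreover have "2 * card E < card N" using Suc.prems(2)[of E] E by (simp add: N_def)
    ultimately show False using deg_sum by simp
  qed
  then obtain y where y: "y \<in> N" "card (deg y) < 2" by blast
  then obtain x where x: "x \<in> E" "y \<in> R ` ({x} \<times> {..<4})" by (auto simp: N_def)
  have unique: "i = x" if "i \<in> E" "y \<in> R ` ({i} \<times> {..<4})" for i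
  proof (rule ccontr)
    assume "i \<noteq> x"
    then have "card {i, x} \<le> card (deg y)"
      using that x fin by (intro card_mono) (auto simp: deg_def)
    then show False using y \<open>i \<noteq> x\<close> by simp
  qed
  have "\<exists>f. inj_on f (E - {x}) \<and> (\<forall>i\<in>E - {x}. f i \<in> R ` ({i} \<times> {..<4}))"
    by (rule Suc.hyps(1)) (use Suc.hyps(2) Suc.prems x in \<open>auto simp: subset_iff\<close>)
  then obtain f where f: "inj_on f (E - {x})" "\<forall>i\<in>E - {x}. f i \<in> R ` ({i} \<times> {..<4})" by blast
  have "f i \<noteq> y" if "i \<in> E - {x}" for i
    using f(2) that unique by blast
  then have "inj_on (f(x := y)) E"
    using f(1) by (auto simp: inj_on_def)
  then show ?case using f(2) x by (intro exI[of _ "f(x := y)"]) auto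
qed

section \<open>Additive functionals below subadditive ones\<close>

text \<open>The infimum over \<open>n\<close> of \<open>p (x + n y) - n p y\<close> is again subadditive and below \<open>p\<close>, hence equal
  to \<open>p\<close>; comparing with \<open>n = 1\<close> gives additivity.\<close>

lemma minimal_subadditive_additive:
  fixes V :: "'v::ab_group_add set" and p :: "'v \<Rightarrow> real"
  assumes add: "\<And>x y. x \<in> V \<Longrightarrow> y \<in> V \<Longrightarrow> x + y \<in> V"
    and neg: "\<And>x. x \<in> V \<Longrightarrow> - x \<in> V"
    and sub: "\<And>x y. x \<in> V \<Longrightarrow> y \<in> V \<Longrightarrow> p (x + y) \<le> p x + p y"
    and min: "\<And>q x. (\<And>x y. x \<in> V \<Longrightarrow> y \<in> V \<Longrightarrow> q (x + y) \<le> q x + q y) \<Longrightarrow>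
      (\<And>x. x \<in> V \<Longrightarrow> q x \<le> p x) \<Longrightarrow> x \<in> V \<Longrightarrow> p x \<le> (q x :: real)"
    and V: "x \<in> V" "y \<in> V"
  shows "p (x + y) = p x + p y"
proof -
  define mult where "mult n z = ((+) z ^^ n) (0::'v)" for n z
  have mult_0 [simp]: "mult 0 z = 0" and mult_Suc [simp]: "mult (Suc n) z = z + mult n z" for n z
    by (simp_all add: mult_def)
  have "x + - x \<in> V" using V add neg by blast
  then have 0: "0 \<in> V" by simp
  have p0: "0 \<le> p 0" using sub[OF 0 0] by simp
  have mult_V: "mult n z \<in> V" if "z \<in> V" for n z
    using that by (induction n) (auto intro: 0 add)
  have mult_add: "mult n (u + v) = mult n u + mult n v" for n u v
    by (induction n) (simp_all add: algebra_simps)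
  have mult_plus: "mult (n + k) z = mult n z + mult k z" for n k z
    by (induction n) (simp_all add: algebra_simps)
  have mult_le: "p (mult (Suc n) z) \<le> real (Suc n) * p z" if "z \<in> V" for n z
  proof (induction n)
    case (Suc n)
    show ?case
      using sub[OF that mult_V[OF that], of "Suc n"] Suc by (simp add: algebra_simps)
  qed simp
  \<comment> \<open>Minimality is tested against a rescaled function \<open>q\<close>, which is
    subadditive and, by \<open>mult_le\<close>, below \<open>p\<close>. The outcome keeps the
    infimum taken later bounded below.\<close>
  have mult_ge: "real n * p z \<le> p (mult n z)" if z: "z \<in> V" for n z
  proof (cases n)
    case (Suc k)
    define q where "q u = p (mult n u) / real n" for u
    have "p z \<le> q z"
    proof (rule min[OF _ _ z])
      fix u v assume "u \<in> V" "v \<in> V"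
      then show "q (u + v) \<le> q u + q v"
        using sub[OF mult_V mult_V, of u v n n] Suc
        by (simp add: q_def mult_add divide_simps add_divide_distrib[symmetric])
    next
      fix u assume "u \<in> V"
      from mult_le[OF this, of k] show "q u \<le> p u" using Suc
        by (simp add: q_def divide_simps mult.commute)
    qed
    then show ?thesis using Suc by (simp add: q_def divide_simps mult.commute)
  qed (simp add: p0)
  define S where "S u = range (\<lambda>n. p (u + mult n y) - real n * p y)" for u
  define q where "q u = Inf (S u)" for u
  have S_ne: "S u \<noteq> {}" for u by (simp add: S_def)
  have S_bdd: "bdd_below (S u)" if u: "u \<in> V" for u
  proof (rule bdd_belowI)
    fix r assume "r \<in> S u"
    then obtain n where r: "r = p (u + mult n y) - real n * p y" by (auto simp: S_def)
    have "p (mult n y) \<le> p (u + mult n y) + p (- u)"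
      using sub[OF add[OF u mult_V[OF V(2)]] neg[OF u], of n] by (simp add: algebra_simps)
    then show "- p (- u) \<le> r" using mult_ge[OF V(2), of n] r by simp
  qed
  have "p x \<le> q x"
  proof (rule min[OF _ _ V(1)])
    fix u v assume uv: "u \<in> V" "v \<in> V"
    have "q (u + v) - b \<le> a" if "a \<in> S u" "b \<in> S v" for a b
    proof -
      from that(1) obtain n where a: "a = p (u + mult n y) - real n * p y"
        unfolding S_def by (rule rangeE)
      from that(2) obtain k where b: "b = p (v + mult k y) - real k * p y"
        unfolding S_def by (rule rangeE)
      have "q (u + v) \<le> p (u + v + mult (n + k) y) - real (n + k) * p y"
        unfolding q_def by (rule cInf_lower[OF _ S_bdd[OF add[OF uv]]]) (unfold S_def, rule rangeI)
      also have "u + v + mult (n + k) y = (u + mult n y) + (v + mult k y)"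
        by (simp add: mult_plus algebra_simps)
      finally show ?thesis
        using sub[OF add[OF uv(1) mult_V[OF V(2), of n]] add[OF uv(2) mult_V[OF V(2), of k]]]
        by (simp add: a b algebra_simps)
    qed
    then have "q (u + v) - b \<le> q u" if "b \<in> S v" for b
      using that by (subst (2) q_def) (rule cInf_greatest[OF S_ne])
    then have "q (u + v) - q u \<le> b" if "b \<in> S v" for b
      using that by (fastforce simp: algebra_simps)
    then have "q (u + v) - q u \<le> q v"
      by (subst (3) q_def) (rule cInf_greatest[OF S_ne])
    then show "q (u + v) \<le> q u + q v" by simp
  next
    fix u assume u: "u \<in> V"
    have "p u \<in> S u" unfolding S_def by (rule range_eqI[of _ _ 0]) simp
    then show "q u \<le> p u" unfolding q_def by (rule cInf_lower[OF _ S_bdd[OF u]])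
  qed
  also have "q x \<le> p (x + y) - p y"
    unfolding q_def
    by (rule cInf_lower[OF _ S_bdd[OF V(1)]]) (auto simp: S_def intro!: range_eqI[of _ _ 1])
  finally show ?thesis using sub[OF V] by simp
qed

text \<open>A form of Hahn-Banach: Zorn's lemma gives a minimal subadditive function below
  \<open>p\<close>, and minimality forces additivity. The setting is an abelian group because
  additivity is all that a charge asks of the functional.\<close>

lemma subadditive_dominates_additive:
  fixes V :: "'v::ab_group_add set" and p :: "'v \<Rightarrow> real"
  assumes add: "\<And>x y. x \<in> V \<Longrightarrow> y \<in> V \<Longrightarrow> x + y \<in> V"
    and neg: "\<And>x. x \<in> V \<Longrightarrow> - x \<in> V"
    and sub: "\<And>x y. x \<in> V \<Longrightarrow> y \<in> V \<Longrightarrow> p (x + y) \<le> p x + p y"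
  obtains L :: "'v \<Rightarrow> real" where "\<And>x y. x \<in> V \<Longrightarrow> y \<in> V \<Longrightarrow> L (x + y) = L x + L y"
    and "\<And>x. x \<in> V \<Longrightarrow> L x \<le> p x"
proof -
  \<comment> \<open>Members of \<open>Q\<close> vanish off \<open>V\<close>, so comparing them as
    total functions compares them on \<open>V\<close>, and infima of nonempty chains exist at every
    argument.\<close>
  define Q where "Q = {q :: 'v \<Rightarrow> real. (\<forall>x\<in>V. \<forall>y\<in>V. q (x + y) \<le> q x + q y) \<and>
    (\<forall>x\<in>V. q x \<le> p x) \<and> (\<forall>x. x \<notin> V \<longrightarrow> q x = 0)}"
  have Q_lower: "- p (- x) \<le> q x" if q: "q \<in> Q" and x: "x \<in> V" for q x
  proof -
    have *: "\<forall>x\<in>V. \<forall>y\<in>V. q (x + y) \<le> q x + q y" using q by (simp add: Q_def)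
    have "x + - x \<in> V" using x add neg by blast
    then have 0: "0 \<in> V" by simp
    from * 0 have "q (0 + 0) \<le> q 0 + q 0" by blast
    moreover from * x neg have "q (x + - x) \<le> q x + q (- x)" by blast
    moreover have "q (- x) \<le> p (- x)" using q neg[OF x] by (simp add: Q_def)
    ultimately show ?thesis by simp
  qed
  \<comment> \<open>The order is reversed because Zorn's lemma produces maximal elements.\<close>
  define le where "le q r \<longleftrightarrow> r \<le> q" for q r :: "'v \<Rightarrow> real"
  have lower: "\<exists>u\<in>Q. \<forall>q\<in>C. u \<le> q" if C: "C \<subseteq> Q" and chain: "\<forall>q\<in>C. \<forall>r\<in>C. q \<le> r \<or> r \<le> q" for C
  proof (cases "C = {}")
    case True
    have "(\<lambda>x. if x \<in> V then p x else 0) \<in> Q" by (simp add: Q_def add sub)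
    then show ?thesis using True by auto
  next
    case False
    define u where "u x = (INF q\<in>C. q x)" for x
    have bdd: "bdd_below ((\<lambda>q. q x) ` C)" for x
    proof (cases "x \<in> V")
      case True
      then show ?thesis using Q_lower C by (intro bdd_belowI2[of _ "- p (- x)"]) auto
    next
      case False
      then show ?thesis using C by (intro bdd_belowI2[of _ 0]) (auto simp: Q_def)
    qed
    have u_le: "u x \<le> q x" if "q \<in> C" for q x
      unfolding u_def by (rule cINF_lower[OF bdd that])
    have u_ge: "b \<le> u x" if "\<And>q. q \<in> C \<Longrightarrow> b \<le> q x" for b x
      unfolding u_def using that by (intro cINF_greatest[OF False]) auto
    have "u (x + y) \<le> u x + u y" if xy: "x \<in> V" "y \<in> V" for x y
    proof -
      \<comment> \<open>The values \<open>u x\<close> and \<open>u y\<close> may be approximated by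
        different members of the chain; a member below both makes subadditivity available.\<close>
      have *: "u (x + y) \<le> q x + r y" if qr: "q \<in> C" "r \<in> C" for q r
      proof -
        obtain s where s: "s \<in> C" "s \<le> q" "s \<le> r" using chain qr by blast
        have "u (x + y) \<le> s (x + y)" by (rule u_le[OF s(1)])
        also have "\<dots> \<le> s x + s y" using s(1) C xy by (auto simp: Q_def)
        also have "\<dots> \<le> q x + r y" using s by (intro add_mono) (auto simp: le_fun_def)
        finally show ?thesis .
      qed
      have "u (x + y) - r y \<le> u x" if "r \<in> C" for r
        by (rule u_ge) (use *[OF _ that] in \<open>auto simp: algebra_simps\<close>)
      then have "u (x + y) - u x \<le> u y"
        by (intro u_ge) (auto simp: algebra_simps)
      then show ?thesis by simp
    qed
    moreover from False obtain q where q: "q \<in> C" by blast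
    moreover have "u x \<le> p x" if "x \<in> V" for x
    proof -
      have "q x \<le> p x" using q C that by (auto simp: Q_def)
      with u_le[OF q, of x] show ?thesis by simp
    qed
    moreover have "u x = 0" if "x \<notin> V" for x
    proof -
      have 0: "r x = 0" if "r \<in> C" for r using that C \<open>x \<notin> V\<close> by (auto simp: Q_def)
      have "0 \<le> u x" by (rule u_ge) (simp add: 0)
      moreover have "u x \<le> 0" using u_le[OF q, of x] 0[OF q] by simp
      ultimately show ?thesis by simp
    qed
    ultimately have "u \<in> Q" by (simp add: Q_def)
    then show ?thesis using u_le by (auto simp: le_fun_def)
  qed
  have "\<exists>m\<in>Q. \<forall>q\<in>Q. le m q \<longrightarrow> q = m"
  proof (rule predicate_Zorn)
    show "partial_order_on Q (relation_of le Q)"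
      by (rule partial_order_on_relation_ofI) (auto simp: le_def)
  next
    fix C assume C: "C \<in> Chains (relation_of le Q)"
    show "\<exists>u\<in>Q. \<forall>q\<in>C. le q u" unfolding le_def
    proof (rule lower)
      show "C \<subseteq> Q" using C by (auto simp: Chains_def relation_of_def)
      show "\<forall>q\<in>C. \<forall>r\<in>C. q \<le> r \<or> r \<le> q"
        using C unfolding Chains_def relation_of_def le_def by blast
    qed
  qed
  then obtain m where m: "m \<in> Q" and min: "\<And>q. q \<in> Q \<Longrightarrow> q \<le> m \<Longrightarrow> q = m"
    by (auto simp: le_def)
  show thesis
  proof (rule that[of m])
    fix x assume "x \<in> V"
    then show "m x \<le> p x" using m by (simp add: Q_def)
  next
    fix x y assume xy: "x \<in> V" "y \<in> V"
    show "m (x + y) = m x + m y"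
    proof (rule minimal_subadditive_additive[OF add neg _ _ xy])
      fix x y assume "x \<in> V" "y \<in> V"
      then show "m (x + y) \<le> m x + m y" using m by (simp add: Q_def)
    next
      fix q :: "'v \<Rightarrow> real" and x
      assume q: "\<And>x y. x \<in> V \<Longrightarrow> y \<in> V \<Longrightarrow> q (x + y) \<le> q x + q y"
        "\<And>x. x \<in> V \<Longrightarrow> q x \<le> m x" and x: "x \<in> V"
      have le_p: "q x \<le> p x" if "x \<in> V" for x
      proof -
        have "m x \<le> p x" using m that by (simp add: Q_def)
        with q(2)[OF that] show ?thesis by simp
      qed
      have "(\<lambda>x. if x \<in> V then q x else 0) = m"
      proof (rule min)
        show "(\<lambda>x. if x \<in> V then q x else 0) \<in> Q" by (simp add: Q_def add q(1) le_p)
        have "m x = 0" if "x \<notin> V" for x using m that by (simp add: Q_def)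
        then show "(\<lambda>x. if x \<in> V then q x else 0) \<le> m" by (simp add: le_fun_def q(2))
      qed
      from fun_cong[OF this, of x] show "m x \<le> q x" using x by simp
    qed
  qed
qed

section \<open>Intersection numbers and finitely additive measures\<close>

text \<open>The existence half of Kelley's theorem. \<open>p f\<close> is the infimum of the upper
  bounds on \<open>X\<close> of \<open>f\<close> plus a finite sum of corrections
  \<open>indicator c - \<delta>\<close>. Concatenating lists makes \<open>p\<close> subadditive, and
  \<open>cover\<close> supplies a point where the correction is non-negative, which keeps
  \<open>p f\<close> above every lower bound of \<open>f\<close>. An additive functional below
  \<open>p\<close> is then positive and sends \<open>\<delta> - indicator c\<close> to at most 0.
  Lists are used because intersection numbers count repetitions.\<close>

lemma ex_charge:
  fixes X :: "'a set" and C :: "'a set set" and \<delta> :: real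
  assumes cover: "\<And>cs. set cs \<subseteq> C \<Longrightarrow>
    \<exists>x\<in>X. \<delta> * length cs \<le> length (filter (\<lambda>c. x \<in> c) cs)"
  obtains \<nu> :: "'a set \<Rightarrow> real" where
    "\<And>a b. a \<inter> b = {} \<Longrightarrow> \<nu> (a \<union> b) = \<nu> a + \<nu> b"
    "\<And>a. 0 \<le> \<nu> a" "\<nu> X = 1" "\<And>c. c \<in> C \<Longrightarrow> \<delta> \<le> \<nu> c"
proof -
  define V where "V = {f :: 'a \<Rightarrow> real. \<exists>M. \<forall>x\<in>X. \<bar>f x\<bar> \<le> M}"
  define g where "g cs x = (\<Sum>c\<leftarrow>cs. indicator c x - \<delta>)" for cs and x :: 'a
  define U where "U f = {M. \<exists>cs. set cs \<subseteq> C \<and> (\<forall>x\<in>X. f x + g cs x \<le> M)}" for f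
  define p where "p f = Inf (U f)" for f
  have g_eq: "g cs x = real (length (filter (\<lambda>c. x \<in> c) cs)) - \<delta> * length cs" for cs x
    by (induction cs) (auto simp: g_def algebra_simps)
  have V_add: "f + h \<in> V" if "f \<in> V" "h \<in> V" for f h
  proof -
    from that obtain M N where "\<forall>x\<in>X. \<bar>f x\<bar> \<le> M" "\<forall>x\<in>X. \<bar>h x\<bar> \<le> N" by (auto simp: V_def)
    then have "\<forall>x\<in>X. \<bar>(f + h) x\<bar> \<le> M + N"
      by (auto intro: order_trans[OF abs_triangle_ineq] add_mono)
    then show ?thesis by (auto simp: V_def)
  qed
  have V_neg: "- f \<in> V" if "f \<in> V" for f using that by (simp add: V_def fun_Compl_def)
  have U_lower: "b \<le> M" if "M \<in> U f" "\<And>x. x \<in> X \<Longrightarrow> b \<le> f x" for b M f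
  proof -
    obtain cs where cs: "set cs \<subseteq> C" "\<And>x. x \<in> X \<Longrightarrow> f x + g cs x \<le> M"
      using \<open>M \<in> U f\<close> by (auto simp: U_def)
    obtain x where x: "x \<in> X" "0 \<le> g cs x" using cover[OF cs(1)] by (auto simp: g_eq)
    show ?thesis using that(2)[OF x(1)] cs(2)[OF x(1)] x(2) by simp
  qed
  have U_bdd: "bdd_below (U f)" if f: "f \<in> V" for f
  proof -
    obtain N where N: "\<forall>x\<in>X. \<bar>f x\<bar> \<le> N" using f by (auto simp: V_def)
    have "- N \<le> M" if "M \<in> U f" for M
    proof (rule U_lower[OF that])
      fix x assume "x \<in> X"
      from bspec[OF N this] show "- N \<le> f x" by simp
    qed
    then show ?thesis by (rule bdd_belowI)
  qed
  have U_I: "M \<in> U f" if "\<And>x. x \<in> X \<Longrightarrow> f x \<le> M" for M f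
    unfolding U_def using that by (auto simp: g_def intro!: exI[of _ "[]"])
  have U_ne: "U f \<noteq> {}" if f: "f \<in> V" for f
  proof -
    obtain N where "\<forall>x\<in>X. \<bar>f x\<bar> \<le> N" using f by (auto simp: V_def)
    then have "N \<in> U f" by (auto intro!: U_I)
    then show ?thesis by blast
  qed
  have p_le: "p f \<le> M" if "f \<in> V" "M \<in> U f" for f M
    unfolding p_def by (rule cInf_lower[OF that(2) U_bdd[OF that(1)]])
  have p_sub: "p (f + h) \<le> p f + p h" if fh: "f \<in> V" "h \<in> V" for f h
  proof -
    have *: "p (f + h) \<le> M + N" if M: "M \<in> U f" and N: "N \<in> U h" for M N
    proof -
      obtain cs where cs: "set cs \<subseteq> C" "\<forall>x\<in>X. f x + g cs x \<le> M" using M by (auto simp: U_def)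
      obtain ds where ds: "set ds \<subseteq> C" "\<forall>x\<in>X. h x + g ds x \<le> N" using N by (auto simp: U_def)
      have "(f + h) x + g (cs @ ds) x \<le> M + N" if "x \<in> X" for x
        using bspec[OF cs(2) that] bspec[OF ds(2) that] by (simp add: g_def)
      then have "M + N \<in> U (f + h)" unfolding U_def using cs(1) ds(1)
        by (intro CollectI exI[of _ "cs @ ds"]) auto
      then show ?thesis by (rule p_le[OF V_add[OF fh]])
    qed
    have "p (f + h) - N \<le> p f" if "N \<in> U h" for N
      unfolding p_def[of f]
      by (rule cInf_greatest[OF U_ne[OF fh(1)]]) (use *[OF _ that] in \<open>simp add: algebra_simps\<close>)
    then have "p (f + h) - p f \<le> p h"
      unfolding p_def[of h]
      by (intro cInf_greatest[OF U_ne[OF fh(2)]]) (simp add: algebra_simps)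
    then show ?thesis by simp
  qed
  obtain L where L_add: "\<And>f h. f \<in> V \<Longrightarrow> h \<in> V \<Longrightarrow> L (f + h) = L f + L h"
    and L_le: "\<And>f. f \<in> V \<Longrightarrow> L f \<le> p f"
    using subadditive_dominates_additive[of V p, OF V_add V_neg p_sub] by blast
  have L_upper: "L f \<le> M" if "f \<in> V" "\<And>x. x \<in> X \<Longrightarrow> f x \<le> M" for f M
    using L_le[OF that(1)] p_le[OF that(1) U_I[OF that(2)]] by simp
  have V_0: "0 \<in> V" by (auto simp: V_def)
  have L_neg: "L (- f) = - L f" if "f \<in> V" for f
    using L_add[OF that V_neg[OF that]] L_add[OF V_0 V_0] by simp
  have L_lower: "M \<le> L f" if "f \<in> V" "\<And>x. x \<in> X \<Longrightarrow> M \<le> f x" for f M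
  proof -
    have "L (- f) \<le> - M" by (rule L_upper[OF V_neg[OF that(1)]]) (simp add: that(2))
    then show ?thesis using L_neg[OF that(1)] by simp
  qed
  have V_ind: "indicator a \<in> V" for a by (auto simp: V_def indicator_def intro!: exI[of _ 1])
  have V_const: "(\<lambda>_. r) \<in> V" for r by (auto simp: V_def)
  show thesis
  proof (rule that[of "\<lambda>a. L (indicator a)"])
    fix a b :: "'a set" assume "a \<inter> b = {}"
    then have "indicator (a \<union> b) = (indicator a + indicator b :: 'a \<Rightarrow> real)"
      by (auto simp: indicator_def fun_eq_iff)
    then show "L (indicator (a \<union> b)) = L (indicator a) + L (indicator b)"
      by (simp add: L_add V_ind)
  next
    fix a show "0 \<le> L (indicator a)" by (rule L_lower[OF V_ind]) simp
  next
    show "L (indicator X) = 1"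
      by (intro antisym L_upper[OF V_ind] L_lower[OF V_ind]) auto
  next
    fix c assume c: "c \<in> C"
    define h where "h = indicator c + - (\<lambda>_. \<delta>)"
    have hV: "h \<in> V" unfolding h_def by (intro V_add V_neg V_ind V_const)
    \<comment> \<open>The single correction \<open>[c]\<close> cancels \<open>- h\<close>
      exactly.\<close>
    have "0 \<in> U (- h)" unfolding U_def using c
      by (auto simp: g_def h_def intro!: exI[of _ "[c]"])
    then have "L (- h) \<le> 0" using L_le p_le V_neg[OF hV] by (metis order_trans)
    then have "0 \<le> L h" using L_neg[OF hV] by simp
    moreover have "L h = L (indicator c) - L (\<lambda>_. \<delta>)"
      unfolding h_def L_add[OF V_ind V_neg[OF V_const]] L_neg[OF V_const] by (rule diff_conv_add_uminus[symmetric])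
    moreover have "\<delta> \<le> L (\<lambda>_. \<delta>)" by (rule L_lower[OF V_const]) simp
    ultimately show "\<delta> \<le> L (indicator c)" by simp
  qed
qed

text \<open>If every point lay in too few of the sets, then, after repeating each set \<open>N + 1\<close> times, the
  indices of the sets through each point could be matched into \<open>l\<close> colours along an expander. This
  cuts each set into 4 colour pieces, one of which is not small, while pieces of the same colour are
  disjoint: more than \<open>N\<close> of the non-small pieces share a colour.\<close>

lemma intersection_number_bound:
  assumes B: "algebra X B" and X: "X \<noteq> {}" and C: "C \<subseteq> B" and empty: "{} \<in> S"
    and union: "\<And>b. (\<And>j. j < 4 \<Longrightarrow> b j \<in> S) \<Longrightarrow> (\<Union>j<4::nat. b j) \<notin> C"
    and exhaustive: "\<And>A. antichain B A \<Longrightarrow> finite A \<Longrightarrow> A \<inter> S = {} \<Longrightarrow> card A \<le> N"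
    and cs: "set cs \<subseteq> C"
  shows "\<exists>x\<in>X. 1 / (216 * (real N + 1)\<^sup>2) * length cs \<le> length (filter (\<lambda>c. x \<in> c) cs)"
proof (rule ccontr)
  assume neg: "\<not> ?thesis"
  interpret algebra X B by fact
  define l where "l = length cs"
  define m where "m = (N + 1) * l"
  define c where "c i = cs ! (i mod l)" for i
  define idx where "idx x = {i. i < m \<and> x \<in> c i}" for x
  have l: "l > 0" using neg X by (cases cs) (auto simp: l_def)
  have lm: "l \<le> m" by (simp add: m_def)
  have cC: "c i \<in> C" for i using cs l by (auto simp: c_def l_def)
  then have cB: "c i \<in> B" for i using C by blast
  \<comment> \<open>Of the two factors \<open>N + 1\<close> in the density, one pays for the
    repetitions in \<open>m\<close> and the other for those in \<open>idx x\<close>; 216 is the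
    constant of the expander.\<close>
  have idx_small: "216 * m * card (idx x) \<le> l\<^sup>2" if x: "x \<in> X" for x
  proof -
    define k where "k = length (filter (\<lambda>c. x \<in> c) cs)"
    have k: "k = card {j. j < l \<and> x \<in> cs ! j}" by (simp add: k_def l_def length_filter_conv_card)
    have "card (idx x) \<le> card ({..N} \<times> {j. j < l \<and> x \<in> cs ! j})"
    proof (rule card_inj_on_le)
      show "inj_on (\<lambda>i. (i div l, i mod l)) (idx x)"
        by (rule inj_onI) (metis Pair_inject div_mult_mod_eq)
      show "(\<lambda>i. (i div l, i mod l)) ` idx x \<subseteq> {..N} \<times> {j. j < l \<and> x \<in> cs ! j}"
        using l by (auto simp: idx_def m_def c_def less_mult_imp_div_less less_Suc_eq_le[symmetric])
    qed simp
    also have "\<dots> = (N + 1) * k" by (simp add: k)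
    finally have idx: "card (idx x) \<le> (N + 1) * k" .
    have "real k < 1 / (216 * (real N + 1)\<^sup>2) * real l" using neg x by (force simp: k_def l_def)
    then have "real (216 * (N + 1)\<^sup>2 * k) < real l" by (simp add: field_simps)
    then have *: "216 * (N + 1)\<^sup>2 * k \<le> l" by linarith
    have "216 * m * card (idx x) \<le> 216 * m * ((N + 1) * k)" using idx by (rule mult_le_mono2)
    also have "\<dots> = l * (216 * (N + 1)\<^sup>2 * k)"
      by (simp only: m_def power2_eq_square ac_simps)
    also have "\<dots> \<le> l * l" using * by (rule mult_le_mono2)
    finally show ?thesis by (simp add: power2_eq_square)
  qed
  obtain R :: "nat \<times> nat \<Rightarrow> nat" where R: "\<And>i j. i < m \<Longrightarrow> j < 4 \<Longrightarrow> R (i, j) < l"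
    and R_exp: "\<And>E. E \<subseteq> {..<m} \<Longrightarrow> E \<noteq> {} \<Longrightarrow> 216 * m * card E \<le> l\<^sup>2 \<Longrightarrow>
      2 * card E < card (R ` (E \<times> {..<4}))"
    using ex_expander[OF l lm] by blast
  have matching: "\<exists>f. inj_on f (idx x) \<and> (\<forall>i\<in>idx x. f i \<in> R ` ({i} \<times> {..<4}))" if x: "x \<in> X" for x
  proof (rule expander_matching)
    show fin: "finite (idx x)" by (simp add: idx_def)
    fix E assume E: "E \<subseteq> idx x" "E \<noteq> {}"
    have "216 * m * card E \<le> 216 * m * card (idx x)"
      by (intro mult_le_mono2 card_mono fin E)
    also have "\<dots> \<le> l\<^sup>2" by (rule idx_small[OF x])
    finally show "2 * card E < card (R ` (E \<times> {..<4}))"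
      using E by (intro R_exp) (auto simp: idx_def)
  qed
  \<comment> \<open>The matching depends on the index set alone and not on the point. Hence each
    piece \<open>b i y\<close> is a finite union of atoms \<open>{x \<in> X. idx x = E}\<close> and
    lies in \<open>B\<close>.\<close>
  define f where "f E = (SOME f. inj_on f E \<and> (\<forall>i\<in>E. f i \<in> R ` ({i} \<times> {..<4})))" for E
  have f_inj: "inj_on (f (idx x)) (idx x)" if "x \<in> X" for x
    using someI_ex[OF matching[OF that]] by (simp add: f_def)
  have f_R: "f (idx x) i \<in> R ` ({i} \<times> {..<4})" if "x \<in> X" "i \<in> idx x" for x i
    using someI_ex[OF matching[OF that(1)]] that(2) by (simp add: f_def)
  define b where "b i y = {x \<in> X. i \<in> idx x \<and> f (idx x) i = y}" for i y
  have atom: "{x \<in> X. idx x = E} \<in> B" for E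
  proof (cases "E \<subseteq> {..<m}")
    case True
    then have "{x \<in> X. idx x = E} = {x \<in> X. \<forall>i\<in>{..<m}. x \<in> c i \<longleftrightarrow> i \<in> E}"
      by (auto simp: idx_def)
    also have "\<dots> \<in> B"
    proof (rule sets_Collect_finite_All')
      fix i show "{x \<in> X. x \<in> c i \<longleftrightarrow> i \<in> E} \<in> B"
      proof (cases "i \<in> E")
        case True
        then have "{x \<in> X. x \<in> c i \<longleftrightarrow> i \<in> E} = c i" using cB sets_into_space by blast
        then show ?thesis using cB by simp
      next
        case False
        then have "{x \<in> X. x \<in> c i \<longleftrightarrow> i \<in> E} = X - c i" by blast
        then show ?thesis using cB by auto
      qed
    qed (use l lm in \<open>auto simp: lessThan_empty_iff\<close>)
    finally show ?thesis .
  next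
    case False
    then have "{x \<in> X. idx x = E} = {}" by (auto simp: idx_def)
    then show ?thesis by (simp only: empty_sets)
  qed
  have b_B: "b i y \<in> B" for i y
  proof -
    have "idx x \<subseteq> {..<m}" for x by (auto simp: idx_def)
    then have "b i y = (\<Union>E\<in>{E. E \<subseteq> {..<m} \<and> i \<in> E \<and> f E i = y}. {x \<in> X. idx x = E})"
      unfolding b_def by blast
    also have "\<dots> \<in> B" by (rule finite_UN[OF _ atom]) simp
    finally show ?thesis .
  qed
  have "\<exists>j<4. b i (R (i, j)) \<notin> S" if i: "i < m" for i
  proof (rule ccontr)
    assume "\<not> ?thesis"
    then have "(\<Union>j<4. b i (R (i, j))) \<notin> C" by (intro union) auto
    moreover have "(\<Union>j<4. b i (R (i, j))) = c i"
    proof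
      show "(\<Union>j<4. b i (R (i, j))) \<subseteq> c i" by (auto simp: b_def idx_def)
      show "c i \<subseteq> (\<Union>j<4. b i (R (i, j)))"
      proof
        fix x assume x: "x \<in> c i"
        then have xX: "x \<in> X" using cB sets_into_space by blast
        have ix: "i \<in> idx x" using x i by (simp add: idx_def)
        from f_R[OF xX ix] show "x \<in> (\<Union>j<4. b i (R (i, j)))" using xX ix by (auto simp: b_def)
      qed
    qed
    ultimately show False using cC by simp
  qed
  then obtain J where J: "\<And>i. i < m \<Longrightarrow> J i < 4 \<and> b i (R (i, J i)) \<notin> S" by metis
  define h where "h i = R (i, J i)" for i
  have h: "h i < l" "b i (h i) \<notin> S" if "i < m" for i using J[OF that] R[OF that] by (auto simp: h_def)
  have fibre: "card {i. i < m \<and> h i = y} \<le> N" for y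
  proof -
    let ?I = "{i. i < m \<and> h i = y}"
    have disj: "b i y \<inter> b k y = {}" if "i \<noteq> k" for i k
      using f_inj that by (auto simp: b_def inj_on_def)
    have ne: "b i y \<noteq> {}" "b i y \<notin> S" if "i \<in> ?I" for i using h(2)[of i] that empty by auto
    have "inj_on (\<lambda>i. b i y) ?I" using disj ne by (intro inj_onI) blast
    then have "card ?I = card ((\<lambda>i. b i y) ` ?I)" by (simp add: card_image)
    also have "\<dots> \<le> N"
    proof (rule exhaustive)
      have "(\<lambda>i. b i y) ` ?I \<subseteq> B - {{}}" using b_B ne(1) by blast
      moreover have "b i y \<inter> b k y = {}" if "b i y \<noteq> b k y" for i k
        using disj[of i k] that by blast
      ultimately show "antichain B ((\<lambda>i. b i y) ` ?I)" unfolding antichain_def by blast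
      show "(\<lambda>i. b i y) ` ?I \<inter> S = {}" using ne(2) by blast
    qed simp
    finally show ?thesis .
  qed
  have "{..<m} = (\<Union>y<l. {i. i < m \<and> h i = y})" using h by auto
  then have "m = card (\<Union>y<l. {i. i < m \<and> h i = y})" by (metis card_lessThan)
  also have "\<dots> \<le> (\<Sum>y<l. card {i. i < m \<and> h i = y})" by (rule card_UN_le) simp
  also have "\<dots> \<le> (\<Sum>y<l. N)" by (intro sum_mono fibre)
  also have "\<dots> = N * l" by simp
  finally show False using l by (simp add: m_def)
qed

section \<open>Order convergence to zero\<close>

text \<open>Order convergence to zero, encoded by a decreasing majorant \<open>d\<close> whose only
  lower bound in \<open>B\<close> is zero. Any convenient majorant may serve, whereas
  \<open>blimsup\<close> prescribes iterated suprema and infima.\<close>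

definition null_seq :: "'a set set \<Rightarrow> (nat \<Rightarrow> 'a set) \<Rightarrow> bool" where
  "null_seq B a \<longleftrightarrow> (\<exists>d. range d \<subseteq> B \<and> decseq d \<and> (\<forall>n. a n \<subseteq> d n) \<and>
     (\<forall>u\<in>B. (\<forall>n. u \<subseteq> d n) \<longrightarrow> u = {}))"

lemma null_seqE:
  assumes "null_seq B a"
  obtains d where "range d \<subseteq> B" "decseq d" "\<forall>n. a n \<subseteq> d n"
    "\<forall>u\<in>B. (\<forall>n. u \<subseteq> d n) \<longrightarrow> u = {}"
  using assms unfolding null_seq_def by (elim exE conjE)

lemma isLub_set_iff:
  "isLub B A s \<longleftrightarrow> s \<in> B \<and> (\<forall>a\<in>A. a \<subseteq> s) \<and> (\<forall>u\<in>B. (\<forall>a\<in>A. a \<subseteq> u) \<longrightarrow> s \<subseteq> (u :: 'a set))"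
  by (auto simp: isLub_def leastP_def isUb_def setle_def setge_def)

lemma isGlb_set_iff:
  "isGlb B A s \<longleftrightarrow> s \<in> B \<and> (\<forall>a\<in>A. s \<subseteq> a) \<and> (\<forall>u\<in>B. (\<forall>a\<in>A. u \<subseteq> a) \<longrightarrow> (u :: 'a set) \<subseteq> s)"
  by (auto simp: isGlb_def greatestP_def isLb_def setle_def setge_def)

locale sigma_complete_algebra = algebra X B for X :: "'a set" and B +
  assumes nonempty: "X \<noteq> {}"
    and ex_isLub: "A \<subseteq> B \<Longrightarrow> countable A \<Longrightarrow> \<exists>s. isLub B A s"
    and ex_isGlb: "A \<subseteq> B \<Longrightarrow> countable A \<Longrightarrow> \<exists>s. isGlb B A s"
begin

lemma bsup_props:
  assumes "A \<subseteq> B" "countable A"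
  shows bsup_isLub: "isLub B A (bsup B A)" and bsup_in: "bsup B A \<in> B"
    and bsup_upper: "a \<in> A \<Longrightarrow> a \<subseteq> bsup B A"
    and bsup_least: "u \<in> B \<Longrightarrow> (\<And>a. a \<in> A \<Longrightarrow> a \<subseteq> u) \<Longrightarrow> bsup B A \<subseteq> u"
proof -
  show *: "isLub B A (bsup B A)" using ex_isLub[OF assms] bsup_eqI by metis
  show "bsup B A \<in> B" "a \<in> A \<Longrightarrow> a \<subseteq> bsup B A"
    "u \<in> B \<Longrightarrow> (\<And>a. a \<in> A \<Longrightarrow> a \<subseteq> u) \<Longrightarrow> bsup B A \<subseteq> u"
    using * unfolding isLub_set_iff by blast+
qed

lemma binf_props:
  assumes "A \<subseteq> B" "countable A"
  shows binf_in: "binf B A \<in> B"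
    and binf_lower: "a \<in> A \<Longrightarrow> binf B A \<subseteq> a"
    and binf_greatest: "u \<in> B \<Longrightarrow> (\<And>a. a \<in> A \<Longrightarrow> u \<subseteq> a) \<Longrightarrow> u \<subseteq> binf B A"
proof -
  have *: "isGlb B A (binf B A)" using ex_isGlb[OF assms] binf_eqI by metis
  show "binf B A \<in> B" "a \<in> A \<Longrightarrow> binf B A \<subseteq> a"
    "u \<in> B \<Longrightarrow> (\<And>a. a \<in> A \<Longrightarrow> u \<subseteq> a) \<Longrightarrow> u \<subseteq> binf B A"
    using * unfolding isGlb_set_iff by blast+
qed

lemma bsup_mono:
  assumes "A \<subseteq> A'" "A' \<subseteq> B" "countable A'"
  shows "bsup B A \<subseteq> bsup B A'"
proof (rule bsup_least)
  show "A \<subseteq> B" "countable A" using assms countable_subset by auto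
  show "bsup B A' \<in> B" by (rule bsup_in[OF assms(2,3)])
  show "a \<subseteq> bsup B A'" if "a \<in> A" for a
    using bsup_upper[OF assms(2,3)] that assms(1) by blast
qed

lemma binf_antimono:
  assumes "A \<subseteq> A'" "A' \<subseteq> B" "countable A'"
  shows "binf B A' \<subseteq> binf B A"
proof (rule binf_greatest)
  show "A \<subseteq> B" "countable A" using assms countable_subset by auto
  show "binf B A' \<in> B" by (rule binf_in[OF assms(2,3)])
  show "binf B A' \<subseteq> a" if "a \<in> A" for a
    using binf_lower[OF assms(2,3)] that assms(1) by blast
qed

text \<open>The suprema of the tails are the canonical majorant. Conversely, any majorant
  \<open>d\<close> bounds these suprema, and the infimum of a tail lies below every
  \<open>d k\<close> because the tail contains terms of arbitrarily large index. The shift by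
  \<open>Suc\<close> reconciles limits that start at 1 with sequences that start at 0.\<close>

lemma blim_empty_iff:
  assumes "\<And>n. n \<ge> 1 \<Longrightarrow> a n \<in> B"
  shows "blim B a {} \<longleftrightarrow> null_seq B (\<lambda>n. a (Suc n))"
proof
  have sub: "a ` {n..} \<subseteq> B" "countable (a ` {n..})" if "n \<ge> 1" for n using assms that by auto
  have range: "(\<lambda>n. bsup B (a ` {n..})) ` {1..} \<subseteq> B" "countable ((\<lambda>n. bsup B (a ` {n..})) ` {1..})"
    using bsup_in[OF sub] by auto
  {
    assume "blim B a {}"
    then have lim: "binf B ((\<lambda>n. bsup B (a ` {n..})) ` {1..}) = {}"
      by (simp add: blim_def blimsup_def)
    show "null_seq B (\<lambda>n. a (Suc n))" unfolding null_seq_def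
    proof (intro exI conjI)
      show "range (\<lambda>n. bsup B (a ` {Suc n..})) \<subseteq> B" using bsup_in[OF sub] by auto
      show "decseq (\<lambda>n. bsup B (a ` {Suc n..}))"
      proof (rule decseq_SucI)
        fix n show "bsup B (a ` {Suc (Suc n)..}) \<subseteq> bsup B (a ` {Suc n..})"
          by (rule bsup_mono[OF _ sub]) auto
      qed
      show "\<forall>n. a (Suc n) \<subseteq> bsup B (a ` {Suc n..})" by (intro allI bsup_upper[OF sub]) auto
      show "\<forall>u\<in>B. (\<forall>n. u \<subseteq> bsup B (a ` {Suc n..})) \<longrightarrow> u = {}"
      proof (intro ballI impI)
        fix u assume u: "u \<in> B" "\<forall>n. u \<subseteq> bsup B (a ` {Suc n..})"
        have "u \<subseteq> binf B ((\<lambda>n. bsup B (a ` {n..})) ` {1..})"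
        proof (rule binf_greatest[OF range u(1)])
          fix s assume "s \<in> (\<lambda>n. bsup B (a ` {n..})) ` {1..}"
          then obtain n where "s = bsup B (a ` {Suc n..})"
            by (metis (no_types, lifting) Suc_le_D One_nat_def atLeast_iff imageE)
          then show "u \<subseteq> s" using u(2) by blast
        qed
        then show "u = {}" using lim by simp
      qed
    qed
  }
  {
    assume "null_seq B (\<lambda>n. a (Suc n))"
    then obtain d where d: "range d \<subseteq> B" "decseq d" "\<forall>n. a (Suc n) \<subseteq> d n"
      and d0': "\<forall>u\<in>B. (\<forall>n. u \<subseteq> d n) \<longrightarrow> u = {}"
      by (rule null_seqE)
    have d0: "u = {}" if "u \<in> B" "\<And>n. u \<subseteq> d n" for u using d0' that by blast
    have a_d: "a k \<subseteq> d n" if "k \<ge> Suc n" for k n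
    proof -
      from that obtain i where i: "k = Suc i" "n \<le> i" using Suc_le_D by force
      then show ?thesis using spec[OF d(3), of i] decseqD[OF d(2) i(2)] by blast
    qed
    have sup: "bsup B (a ` {Suc n..}) \<subseteq> d n" for n
      by (rule bsup_least[OF sub]) (use d(1) a_d in \<open>auto simp: subset_iff\<close>)
    have "blimsup B a = {}" unfolding blimsup_def
    proof (rule d0)
      show "binf B ((\<lambda>n. bsup B (a ` {n..})) ` {1..}) \<in> B" by (rule binf_in[OF range])
      fix n show "binf B ((\<lambda>n. bsup B (a ` {n..})) ` {1..}) \<subseteq> d n"
        by (rule subset_trans[OF binf_lower[OF range] sup]) auto
    qed
    moreover have "bliminf B a = {}"
    proof -
      have "binf B (a ` {n..}) = {}" if n: "n \<ge> 1" for n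
      proof (rule d0)
        show "binf B (a ` {n..}) \<in> B" by (rule binf_in[OF sub[OF n]])
        fix k
        have "binf B (a ` {n..}) \<subseteq> a (Suc (max n k))"
          by (rule binf_lower[OF sub[OF n]]) auto
        also have "\<dots> \<subseteq> d k" by (rule a_d) simp
        finally show "binf B (a ` {n..}) \<subseteq> d k" .
      qed
      then have "(\<lambda>n. binf B (a ` {n..})) ` {1..} = {{}}" by (auto simp: image_iff)
      moreover have "isLub B {{}} {}" by (simp add: isLub_set_iff)
      ultimately show ?thesis by (simp add: bliminf_def bsup_eqI)
    qed
    ultimately show "blim B a {}" by (simp add: blim_def)
  }
qed

text \<open>Dual to convergence to zero: the complements of the infima of the tails now form the
  canonical majorant.\<close>

lemma blim_space_iff:
  assumes "\<And>n. n \<ge> 1 \<Longrightarrow> a n \<in> B"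
  shows "blim B a X \<longleftrightarrow> null_seq B (\<lambda>n. X - a (Suc n))"
proof
  have sub: "a ` {n..} \<subseteq> B" "countable (a ` {n..})" if "n \<ge> 1" for n using assms that by auto
  have range: "(\<lambda>n. binf B (a ` {n..})) ` {1..} \<subseteq> B" "countable ((\<lambda>n. binf B (a ` {n..})) ` {1..})"
    using binf_in[OF sub] by auto
  {
    assume "blim B a X"
    then have lim: "bsup B ((\<lambda>n. binf B (a ` {n..})) ` {1..}) = X"
      by (simp add: blim_def bliminf_def)
    show "null_seq B (\<lambda>n. X - a (Suc n))" unfolding null_seq_def
    proof (intro exI conjI)
      show "range (\<lambda>n. X - binf B (a ` {Suc n..})) \<subseteq> B" using binf_in[OF sub] by auto
      show "decseq (\<lambda>n. X - binf B (a ` {Suc n..}))"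
      proof (rule decseq_SucI)
        fix n have "binf B (a ` {Suc n..}) \<subseteq> binf B (a ` {Suc (Suc n)..})"
          by (rule binf_antimono[OF _ sub]) auto
        then show "X - binf B (a ` {Suc (Suc n)..}) \<subseteq> X - binf B (a ` {Suc n..})" by blast
      qed
      show "\<forall>n. X - a (Suc n) \<subseteq> X - binf B (a ` {Suc n..})"
        by (intro allI Diff_mono order_refl binf_lower[OF sub]) auto
      show "\<forall>u\<in>B. (\<forall>n. u \<subseteq> X - binf B (a ` {Suc n..})) \<longrightarrow> u = {}"
      proof (intro ballI impI)
        fix u assume u: "u \<in> B" "\<forall>n. u \<subseteq> X - binf B (a ` {Suc n..})"
        have "bsup B ((\<lambda>n. binf B (a ` {n..})) ` {1..}) \<subseteq> X - u"
        proof (rule bsup_least[OF range compl_sets[OF u(1)]])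
          fix s assume s: "s \<in> (\<lambda>n. binf B (a ` {n..})) ` {1..}"
          then obtain n where n: "s = binf B (a ` {Suc n..})"
            by (metis (no_types, lifting) Suc_le_D One_nat_def atLeast_iff imageE)
          have "s \<subseteq> X" using s range(1) sets_into_space by blast
          then show "s \<subseteq> X - u" using u(2) n by blast
        qed
        then show "u = {}" using lim sets_into_space[OF u(1)] by blast
      qed
    qed
  }
  {
    assume "null_seq B (\<lambda>n. X - a (Suc n))"
    then obtain d where d: "range d \<subseteq> B" "decseq d" "\<forall>n. X - a (Suc n) \<subseteq> d n"
      and d0': "\<forall>u\<in>B. (\<forall>n. u \<subseteq> d n) \<longrightarrow> u = {}"
      by (rule null_seqE)
    have d0: "u = {}" if "u \<in> B" "\<And>n. u \<subseteq> d n" for u using d0' that by blast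
    have a_d: "X - a k \<subseteq> d n" if "k \<ge> Suc n" for k n
    proof -
      from that obtain i where i: "k = Suc i" "n \<le> i" using Suc_le_D by force
      then show ?thesis using spec[OF d(3), of i] decseqD[OF d(2) i(2)] by blast
    qed
    have eq_X: "s = X" if s: "s \<in> B" "\<And>n. X - d n \<subseteq> s" for s
    proof -
      have "X - s = {}" by (rule d0) (use s in auto)
      then show ?thesis using sets_into_space[OF s(1)] by blast
    qed
    have inf: "X - d n \<subseteq> binf B (a ` {Suc n..})" for n
      by (rule binf_greatest[OF sub]) (use d(1) a_d in \<open>auto simp: subset_iff\<close>)
    have "bliminf B a = X" unfolding bliminf_def
    proof (rule eq_X)
      show "bsup B ((\<lambda>n. binf B (a ` {n..})) ` {1..}) \<in> B" by (rule bsup_in[OF range])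
      fix n show "X - d n \<subseteq> bsup B ((\<lambda>n. binf B (a ` {n..})) ` {1..})"
        by (rule subset_trans[OF inf bsup_upper[OF range]]) auto
    qed
    moreover have "blimsup B a = X"
    proof -
      have "bsup B (a ` {n..}) = X" if n: "n \<ge> 1" for n
      proof (rule eq_X)
        show "bsup B (a ` {n..}) \<in> B" by (rule bsup_in[OF sub[OF n]])
        fix k
        have "X - d k \<subseteq> a (Suc (max n k))" using a_d[of k "Suc (max n k)"] by auto
        also have "\<dots> \<subseteq> bsup B (a ` {n..})"
          by (rule bsup_upper[OF sub[OF n]]) auto
        finally show "X - d k \<subseteq> bsup B (a ` {n..})" .
      qed
      then have "(\<lambda>n. bsup B (a ` {n..})) ` {1..} = {X}" by (auto simp: image_iff)
      moreover have "isGlb B {X} X" by (simp add: isGlb_set_iff)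
      ultimately show ?thesis by (simp add: blimsup_def binf_eqI)
    qed
    ultimately show "blim B a X" by (simp add: blim_def)
  }
qed

text \<open>If \<open>u\<close> lies below \<open>d n \<union> e n\<close> for all \<open>n\<close>,
  then for fixed \<open>k\<close> monotonicity puts \<open>u - d k\<close> below every
  \<open>e n\<close>, so it vanishes; hence \<open>u\<close> lies below every
  \<open>d k\<close>.\<close>

lemma null_seq_Un:
  assumes "null_seq B a" "null_seq B b"
  shows "null_seq B (\<lambda>n. a n \<union> b n)"
proof -
  obtain d where d: "range d \<subseteq> B" "decseq d" "\<forall>n. a n \<subseteq> d n"
    and d0': "\<forall>u\<in>B. (\<forall>n. u \<subseteq> d n) \<longrightarrow> u = {}"
      by (rule null_seqE[OF assms(1)])
    have d0: "u = {}" if "u \<in> B" "\<And>n. u \<subseteq> d n" for u using d0' that by blast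
  obtain e where e: "range e \<subseteq> B" "decseq e" "\<forall>n. b n \<subseteq> e n"
    and e0': "\<forall>u\<in>B. (\<forall>n. u \<subseteq> e n) \<longrightarrow> u = {}"
      by (rule null_seqE[OF assms(2)])
    have e0: "u = {}" if "u \<in> B" "\<And>n. u \<subseteq> e n" for u using e0' that by blast
  show ?thesis unfolding null_seq_def
  proof (intro exI conjI)
    show "range (\<lambda>n. d n \<union> e n) \<subseteq> B" using d(1) e(1) by auto
    show "decseq (\<lambda>n. d n \<union> e n)" using d(2) e(2) by (fastforce simp: decseq_def)
    show "\<forall>n. a n \<union> b n \<subseteq> d n \<union> e n" using d(3) e(3) by blast
    show "\<forall>u\<in>B. (\<forall>n. u \<subseteq> d n \<union> e n) \<longrightarrow> u = {}"
    proof (intro ballI impI)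
      fix u assume u: "u \<in> B" "\<forall>n. u \<subseteq> d n \<union> e n"
      have "u - d k = {}" for k
      proof (rule e0)
        show "u - d k \<in> B" using u(1) d(1) by auto
        fix n
        have "u \<subseteq> d (max n k) \<union> e (max n k)" using u(2) by blast
        then show "u - d k \<subseteq> e n"
          using decseqD[OF d(2), of k "max n k"] decseqD[OF e(2), of n "max n k"] by auto
      qed
      then show "u = {}" using d0[OF u(1)] by blast
    qed
  qed
qed

end

section \<open>Neighbourhood bases of zero and the charges obtained from them\<close>

text \<open>\<open>S k\<close> plays the role of a countable neighbourhood base of zero.\<close>

locale null_base = sigma_complete_algebra X B for X :: "'a set" and B +
  fixes S :: "nat \<Rightarrow> 'a set set"
  assumes S_sets: "S k \<subseteq> B"
    and S_null: "(\<And>n. a n \<in> S n) \<Longrightarrow> null_seq B a"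
    and null_S: "range a \<subseteq> B \<Longrightarrow> null_seq B a \<Longrightarrow> \<exists>n0. \<forall>n\<ge>n0. a n \<in> S k"
begin

lemma empty_in_S: "{} \<in> S k"
proof -
  have "null_seq B (\<lambda>n. {})" unfolding null_seq_def
    by (rule exI[of _ "\<lambda>n. {}"]) (auto simp: decseq_def)
  then show ?thesis using null_S[of "\<lambda>n. {}" k] by auto
qed

text \<open>Otherwise the constant sequence at \<open>a\<close> would be null. The complements of
  the \<open>S k\<close> thus exhaust the nonzero elements, which is what makes the weighted sum of
  charges strictly positive.\<close>

lemma ex_not_in_S:
  assumes "a \<in> B" "a \<noteq> {}"
  shows "\<exists>k. a \<notin> S k"
proof (rule ccontr)
  assume "\<not> ?thesis"
  then have "null_seq B (\<lambda>n. a)" using S_null[of "\<lambda>n. a"] by blast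
  then obtain d where "range d \<subseteq> B" "decseq d" "\<forall>n. a \<subseteq> d n" "\<forall>u\<in>B. (\<forall>n. u \<subseteq> d n) \<longrightarrow> u = {}"
    by (rule null_seqE)
  then show False using assms by simp
qed

text \<open>Stands in for the triangle inequality of a submeasure. If every \<open>j\<close> failed,
  the failing pairs would form two null sequences whose unions, again null, never enter
  \<open>S k\<close>.\<close>

lemma S_union: "\<exists>j. \<forall>a\<in>S j. \<forall>b\<in>S j. a \<union> b \<in> S k"
proof (rule ccontr)
  assume "\<not> ?thesis"
  then obtain a b where a: "\<And>j. a j \<in> S j" and b: "\<And>j. b j \<in> S j" and ab: "\<And>j. a j \<union> b j \<notin> S k"
    by metis
  have "null_seq B (\<lambda>n. a n \<union> b n)" using a b by (intro null_seq_Un S_null)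
  moreover have "range (\<lambda>n. a n \<union> b n) \<subseteq> B" using a b S_sets by blast
  ultimately show False using null_S[of "\<lambda>n. a n \<union> b n" k] ab by blast
qed

text \<open>Four is the left degree of the expander, hence the number of pieces into which an
  element is cut.\<close>

lemma S_union4: "\<exists>j. \<forall>b. (\<forall>i<4. b i \<in> S j) \<longrightarrow> (\<Union>i<4::nat. b i) \<in> S k"
proof -
  obtain j where j: "\<And>a b. a \<in> S j \<Longrightarrow> b \<in> S j \<Longrightarrow> a \<union> b \<in> S k"
    using S_union[of k] by blast
  obtain i where i: "\<And>a b. a \<in> S i \<Longrightarrow> b \<in> S i \<Longrightarrow> a \<union> b \<in> S j"
    using S_union[of j] by blast
  have four: "{..<4} = {0, 1, 2, 3::nat}" by auto
  have "(\<Union>n<4::nat. b n) \<in> S k" if "\<forall>n<4. b n \<in> S i" for b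
  proof -
    have "(b 0 \<union> b 1) \<union> (b 2 \<union> b 3) \<in> S k" using that by (intro j i) auto
    then show ?thesis by (simp add: four Un_assoc)
  qed
  then show ?thesis by blast
qed

text \<open>Antichains of unbounded size off \<open>S k\<close> would supply one of size at least
  \<open>2 ^ n\<close> for each \<open>n\<close>. Concentration picks from these a null sequence,
  which would have to enter \<open>S k\<close>.\<close>

lemma concentrated_exhaustive:
  assumes "concentrated B"
  shows "\<exists>N. \<forall>A. antichain B A \<longrightarrow> finite A \<longrightarrow> A \<inter> S k = {} \<longrightarrow> card A \<le> N"
proof (rule ccontr)
  assume "\<not> ?thesis"
  then have "\<forall>n. \<exists>A. antichain B A \<and> finite A \<and> A \<inter> S k = {} \<and> 2 ^ n \<le> card A"
    by (meson nat_le_linear)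
  then obtain A where A: "\<And>n::nat. antichain B (A n) \<and> finite (A n) \<and> A n \<inter> S k = {} \<and> 2 ^ n \<le> card (A n)"
    by metis
  then obtain a where a: "\<forall>n\<ge>1. a n \<in> A n" "blim B a {}"
    using assms unfolding concentrated_def by blast
  have aB: "a n \<in> B" if "n \<ge> 1" for n
    using a(1) that A[of n] by (auto simp: antichain_def)
  have "null_seq B (\<lambda>n. a (Suc n))" using a(2) blim_empty_iff[of a] aB by simp
  then obtain n where "a (Suc n) \<in> S k" using null_S[of "\<lambda>n. a (Suc n)" k] aB by auto
  moreover have "a (Suc n) \<in> A (Suc n)" using a(1) by simp
  ultimately show False using A[of "Suc n"] by blast
qed


text \<open>The antichain bound \<open>N\<close> is taken off \<open>S j\<close>, where unions of
  four members of \<open>S j\<close> lie in \<open>S k\<close>: cutting an element off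
  \<open>S k\<close> into four leaves a piece off \<open>S j\<close>. The bound
  \<open>\<delta>\<close> is determined by \<open>N\<close>.\<close>

lemma ex_charge_off_S:
  assumes "concentrated B"
  obtains \<nu> :: "'a set \<Rightarrow> real" and \<delta> :: real where
    "\<And>a b. a \<inter> b = {} \<Longrightarrow> \<nu> (a \<union> b) = \<nu> a + \<nu> b"
    "\<And>a. 0 \<le> \<nu> a" "\<nu> X = 1" "0 < \<delta>" "\<And>a. a \<in> B \<Longrightarrow> a \<notin> S k \<Longrightarrow> \<delta> \<le> \<nu> a"
proof -
  obtain j where j: "\<And>b. (\<forall>i<4. b i \<in> S j) \<Longrightarrow> (\<Union>i<4::nat. b i) \<in> S k" using S_union4 by blast
  obtain N where N: "\<And>A. antichain B A \<Longrightarrow> finite A \<Longrightarrow> A \<inter> S j = {} \<Longrightarrow> card A \<le> N"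
    using concentrated_exhaustive[OF assms] by blast
  define \<delta> where "\<delta> = 1 / (216 * (real N + 1)\<^sup>2)"
  have "real N + 1 > 0" by simp
  then have pos: "0 < \<delta>" by (simp add: \<delta>_def)
  obtain \<nu> :: "'a set \<Rightarrow> real" where "\<And>a b. a \<inter> b = {} \<Longrightarrow> \<nu> (a \<union> b) = \<nu> a + \<nu> b"
    "\<And>a. 0 \<le> \<nu> a" "\<nu> X = 1" "\<And>c. c \<in> B - S k \<Longrightarrow> \<delta> \<le> \<nu> c"
  proof (rule ex_charge[of "B - S k" X \<delta>])
    fix cs assume cs: "set cs \<subseteq> B - S k"
    show "\<exists>x\<in>X. \<delta> * length cs \<le> length (filter (\<lambda>c. x \<in> c) cs)"
      unfolding \<delta>_def
      by (rule intersection_number_bound[of X B "B - S k" "S j"])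
         (use cs j N in \<open>auto simp: nonempty empty_in_S algebra_axioms\<close>)
  qed (use that in blast)
  then show thesis using pos by (intro that[of \<nu> \<delta>]) auto
qed

lemma ex_strictly_positive_charge:
  assumes "concentrated B"
  obtains \<nu> :: "'a set \<Rightarrow> real" where
    "\<And>a b. a \<in> B \<Longrightarrow> b \<in> B \<Longrightarrow> a \<inter> b = {} \<Longrightarrow> \<nu> (a \<union> b) = \<nu> a + \<nu> b"
    "\<And>a. a \<in> B \<Longrightarrow> 0 \<le> \<nu> a" "\<And>a. a \<in> B \<Longrightarrow> a \<noteq> {} \<Longrightarrow> 0 < \<nu> a"
proof -
  have "\<exists>\<nu> \<delta>. (\<forall>a b. a \<inter> b = {} \<longrightarrow> \<nu> (a \<union> b) = \<nu> a + \<nu> b) \<and> (\<forall>a. 0 \<le> \<nu> a) \<and> \<nu> X = 1 \<and>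
      (0::real) < \<delta> \<and> (\<forall>a\<in>B. a \<notin> S k \<longrightarrow> \<delta> \<le> \<nu> a)" for k
    by (rule ex_charge_off_S[OF assms, of k]) blast
  then obtain \<mu> :: "nat \<Rightarrow> 'a set \<Rightarrow> real" and \<delta> :: "nat \<Rightarrow> real" where
    add: "\<And>k a b. a \<inter> b = {} \<Longrightarrow> \<mu> k (a \<union> b) = \<mu> k a + \<mu> k b"
    and nonneg: "\<And>k a. 0 \<le> \<mu> k a" and one: "\<And>k. \<mu> k X = 1"
    and pos: "\<And>k. 0 < \<delta> k" and ge: "\<And>k a. a \<in> B \<Longrightarrow> a \<notin> S k \<Longrightarrow> \<delta> k \<le> \<mu> k a"
    by metis
  have le_1: "\<mu> k a \<le> 1" if "a \<in> B" for k a
  proof -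
    have "a \<union> (X - a) = X" using sets_into_space[OF that] by blast
    then show ?thesis using add[of a "X - a" k] nonneg[of k "X - a"] one[of k] by simp
  qed
  \<comment> \<open>The total mass is 2; normalisation is postponed until the charge has been made
    countably additive.\<close>
  define \<nu> where "\<nu> a = (\<Sum>k. (1/2) ^ k * \<mu> k a)" for a
  have summable: "summable (\<lambda>k. (1/2) ^ k * \<mu> k a)" if "a \<in> B" for a
  proof (rule summable_comparison_test')
    show "summable (\<lambda>k. (1/2::real) ^ k)" by (rule summable_geometric) simp
    show "norm ((1/2) ^ k * \<mu> k a) \<le> (1/2) ^ k" for k
      using le_1[OF that, of k] nonneg[of k a] by (simp add: mult_left_le)
  qed
  show thesis
  proof (rule that[of \<nu>])
    fix a b assume ab: "a \<in> B" "b \<in> B" "a \<inter> b = {}"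
    show "\<nu> (a \<union> b) = \<nu> a + \<nu> b"
      unfolding \<nu>_def
      by (simp add: add[OF ab(3)] distrib_left suminf_add[OF summable[OF ab(1)] summable[OF ab(2)]])
  next
    fix a assume a: "a \<in> B"
    show "0 \<le> \<nu> a" unfolding \<nu>_def by (intro suminf_nonneg summable a) (simp add: nonneg)
    assume "a \<noteq> {}"
    then obtain k where k: "a \<notin> S k" using ex_not_in_S a by blast
    have "0 < \<mu> k a" using ge[OF a k] pos[of k] by simp
    then show "0 < \<nu> a" unfolding \<nu>_def
      by (intro suminf_pos2[of _ k] summable a) (auto simp: nonneg)
  qed
qed

end

section \<open>The countably additive part\<close>

context null_base
begin

text \<open>The numbers that bound \<open>\<nu>\<close> along some sequence of elements increasing to \<open>a\<close>.\<close>

definition exhaustion_bounds :: "('a set \<Rightarrow> real) \<Rightarrow> 'a set \<Rightarrow> real set" where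
  "exhaustion_bounds \<nu> a =
    {r. \<exists>b. range b \<subseteq> B \<and> incseq b \<and> isLub B (range b) a \<and> (\<forall>j. \<nu> (b j) \<le> r)}"

context
  fixes \<nu> :: "'a set \<Rightarrow> real"
  assumes nu_add: "\<And>a b. a \<in> B \<Longrightarrow> b \<in> B \<Longrightarrow> a \<inter> b = {} \<Longrightarrow> \<nu> (a \<union> b) = \<nu> a + \<nu> b"
    and nu_nonneg: "\<And>a. a \<in> B \<Longrightarrow> 0 \<le> \<nu> a"
    and nu_pos: "\<And>a. a \<in> B \<Longrightarrow> a \<noteq> {} \<Longrightarrow> 0 < \<nu> a"
begin

text \<open>The countably additive part of the Yosida-Hewitt decomposition. A countably additive
  charge below \<open>\<nu>\<close> is continuous along exhausting sequences and so stays below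
  every exhaustion bound; this infimum is the largest such charge.\<close>

definition "sigma_part a = Inf (exhaustion_bounds \<nu> a)"

lemma nu_mono:
  assumes "a \<in> B" "b \<in> B" "a \<subseteq> b"
  shows "\<nu> a \<le> \<nu> b"
proof -
  have eq: "a \<union> (b - a) = b" using assms(3) by blast
  have "b - a \<in> B" using assms by blast
  then show ?thesis using nu_add[OF assms(1), of "b - a"] nu_nonneg[of "b - a"]
    unfolding eq by simp
qed

lemma nu_empty: "\<nu> {} = 0"
  using nu_add[of "{}" "{}"] by simp

lemma exhaustion_bounds_nonneg:
  assumes "r \<in> exhaustion_bounds \<nu> a"
  shows "0 \<le> r"
proof -
  obtain b :: "nat \<Rightarrow> 'a set" where "range b \<subseteq> B" "\<forall>j. \<nu> (b j) \<le> r"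
    using assms unfolding exhaustion_bounds_def by blast
  then show ?thesis using nu_nonneg[of "b 0"] by (meson order_trans range_subsetD)
qed

lemma sigma_part_le: "r \<in> exhaustion_bounds \<nu> a \<Longrightarrow> sigma_part a \<le> r"
  unfolding sigma_part_def by (rule cInf_lower) (auto intro: bdd_belowI exhaustion_bounds_nonneg)

lemma nu_in_exhaustion_bounds:
  assumes "a \<in> B"
  shows "\<nu> a \<in> exhaustion_bounds \<nu> a"
  unfolding exhaustion_bounds_def using assms
  by (intro CollectI exI[of _ "\<lambda>_. a"]) (auto simp: isLub_set_iff)

lemma sigma_part_ge:
  assumes "a \<in> B" "\<And>r. r \<in> exhaustion_bounds \<nu> a \<Longrightarrow> M \<le> r"
  shows "M \<le> sigma_part a"
  unfolding sigma_part_def by (rule cInf_greatest) (use assms nu_in_exhaustion_bounds in auto)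

lemma sigma_part_nonneg: "a \<in> B \<Longrightarrow> 0 \<le> sigma_part a"
  by (rule sigma_part_ge[OF _ exhaustion_bounds_nonneg])

lemma sigma_part_empty: "sigma_part {} = 0"
proof -
  have "sigma_part {} \<le> \<nu> {}" by (intro sigma_part_le nu_in_exhaustion_bounds empty_sets)
  then show ?thesis using nu_empty sigma_part_nonneg[OF empty_sets] by simp
qed

text \<open>Meets distribute over existing suprema: if \<open>u\<close> bounds the traces on
  \<open>a\<close>, then \<open>u \<union> (X - a)\<close> bounds the original sequence.\<close>

lemma isLub_Int:
  assumes b: "range b \<subseteq> B" and lub: "isLub B (range b) s" and a: "a \<in> B" "a \<subseteq> s"
  shows "isLub B (range (\<lambda>j. b j \<inter> a)) a"
  unfolding isLub_set_iff
proof (intro conjI ballI impI)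
  fix u assume u: "u \<in> B" "\<forall>c\<in>range (\<lambda>j. b j \<inter> a). c \<subseteq> u"
  have "\<forall>c\<in>range b. c \<subseteq> u \<union> (X - a)"
  proof
    fix c assume c: "c \<in> range b"
    then have "c \<subseteq> X" using b sets_into_space by blast
    moreover have "c \<inter> a \<subseteq> u" using u(2) c by auto
    ultimately show "c \<subseteq> u \<union> (X - a)" by blast
  qed
  moreover have "u \<union> (X - a) \<in> B" using u(1) a(1) by blast
  ultimately have "s \<subseteq> u \<union> (X - a)" using lub unfolding isLub_set_iff by simp
  then show "a \<subseteq> u" using a(2) by blast
qed (use a in auto)

lemma sigma_part_superadd:
  assumes ab: "a \<in> B" "b \<in> B" "a \<inter> b = {}"
  shows "sigma_part a + sigma_part b \<le> sigma_part (a \<union> b)"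
proof (rule sigma_part_ge)
  show "a \<union> b \<in> B" using ab by blast
  fix r assume "r \<in> exhaustion_bounds \<nu> (a \<union> b)"
  then obtain c where c: "range c \<subseteq> B" "incseq c" "isLub B (range c) (a \<union> b)" "\<forall>j. \<nu> (c j) \<le> r"
    unfolding exhaustion_bounds_def by (elim CollectE exE conjE)
  have cB: "c j \<in> B" for j using c(1) by auto
  \<comment> \<open>Independent indices \<open>i\<close> and \<open>j\<close> let the infimum for
    \<open>a\<close> be taken with \<open>j\<close> fixed, and the infimum for \<open>b\<close>
    afterwards.\<close>
  have le: "\<nu> (c i \<inter> a) + \<nu> (c j \<inter> b) \<le> r" for i j
  proof -
    let ?k = "max i j"
    have "c i \<subseteq> c ?k" "c j \<subseteq> c ?k" using incseqD[OF c(2)] by auto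
    then have "\<nu> (c i \<inter> a \<union> c j \<inter> b) \<le> \<nu> (c ?k)"
      using ab cB by (intro nu_mono) blast+
    moreover have "\<nu> (c i \<inter> a \<union> c j \<inter> b) = \<nu> (c i \<inter> a) + \<nu> (c j \<inter> b)"
      using ab cB by (intro nu_add) blast+
    ultimately show ?thesis using spec[OF c(4), of ?k] by linarith
  qed
  have inc: "incseq (\<lambda>j. c j \<inter> e)" for e using c(2) by (auto simp: incseq_def)
  have bound: "r' \<in> exhaustion_bounds \<nu> e"
    if e: "e \<in> B" "e \<subseteq> a \<union> b" and r': "\<And>j. \<nu> (c j \<inter> e) \<le> r'" for r' e
    unfolding exhaustion_bounds_def
    using isLub_Int[OF c(1,3) e] inc e(1) cB r' by (intro CollectI exI[of _ "\<lambda>j. c j \<inter> e"]) blast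
  have "sigma_part a \<le> r - \<nu> (c j \<inter> b)" for j
    by (intro sigma_part_le bound) (use ab le in \<open>auto simp: algebra_simps\<close>)
  then have "sigma_part b \<le> r - sigma_part a"
    by (intro sigma_part_le bound) (use ab in \<open>auto simp: algebra_simps\<close>)
  then show "sigma_part a + sigma_part b \<le> r" by simp
qed

lemma sigma_part_mono:
  assumes "a \<in> B" "b \<in> B" "a \<subseteq> b"
  shows "sigma_part a \<le> sigma_part b"
proof -
  have eq: "a \<union> (b - a) = b" using assms(3) by blast
  have "b - a \<in> B" using assms by blast
  then show ?thesis
    using sigma_part_superadd[OF assms(1), of "b - a"] sigma_part_nonneg[of "b - a"]
    unfolding eq by simp
qed

text \<open>Each \<open>a n\<close> gets an exhaustion \<open>b n\<close> whose charges exceed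
  \<open>sigma_part (a n)\<close> by at most \<open>\<epsilon> * (1/2) ^ Suc n\<close>; the diagonal
  unions of the \<open>b n j\<close> with \<open>n < j\<close> exhaust \<open>s\<close> and stay
  below \<open>M + \<epsilon>\<close>. Bounding partial sums by \<open>M\<close> makes the statement
  usable before summability is known.\<close>

lemma sigma_part_subadd:
  fixes a :: "nat \<Rightarrow> 'a set"
  assumes a: "\<And>n. a n \<in> B" and disj: "disjoint_family a" and lub: "isLub B (range a) s"
    and M: "\<And>n. (\<Sum>i<n. sigma_part (a i)) \<le> M"
  shows "sigma_part s \<le> M"
proof (rule field_le_epsilon)
  fix \<epsilon> :: real assume \<epsilon>: "0 < \<epsilon>"
  have "\<exists>b. range b \<subseteq> B \<and> incseq b \<and> isLub B (range b) (a n) \<and>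
      (\<forall>j. \<nu> (b j) \<le> sigma_part (a n) + \<epsilon> * (1/2) ^ Suc n)" for n
  proof -
    have "Inf (exhaustion_bounds \<nu> (a n)) < sigma_part (a n) + \<epsilon> * (1/2) ^ Suc n"
      using \<epsilon> by (simp add: sigma_part_def)
    then obtain r where r: "r \<in> exhaustion_bounds \<nu> (a n)" "r < sigma_part (a n) + \<epsilon> * (1/2) ^ Suc n"
      using nu_in_exhaustion_bounds[OF a] by (metis cInf_lessD empty_iff)
    from r(1) obtain b where b: "range b \<subseteq> B" "incseq b" "isLub B (range b) (a n)" "\<forall>j. \<nu> (b j) \<le> r"
      unfolding exhaustion_bounds_def by (elim CollectE exE conjE)
    have "\<nu> (b j) \<le> sigma_part (a n) + \<epsilon> * (1/2) ^ Suc n" for j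
      using spec[OF b(4), of j] r(2) by linarith
    then show ?thesis using b(1-3) by blast
  qed
  then obtain b where b: "\<And>n. range (b n) \<subseteq> B" "\<And>n. incseq (b n)"
    "\<And>n. isLub B (range (b n)) (a n)"
    "\<And>n j. \<nu> (b n j) \<le> sigma_part (a n) + \<epsilon> * (1/2) ^ Suc n" by metis
  have bB: "b n j \<in> B" for n j using b(1) by blast
  have b_sub: "b n j \<subseteq> a n" for n j using b(3)[of n] by (auto simp: isLub_set_iff)
  define d where "d j = (\<Union>n<j. b n j)" for j
  have dB: "d j \<in> B" for j unfolding d_def using bB by (intro finite_UN) auto
  have "M + \<epsilon> \<in> exhaustion_bounds \<nu> s" unfolding exhaustion_bounds_def
  proof (intro CollectI exI[of _ d] conjI allI)
    show "range d \<subseteq> B" using dB by blast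
    show "incseq d"
    proof (rule incseq_SucI)
      fix j
      have "b n j \<subseteq> b n (Suc j)" for n using b(2)[of n] by (simp add: incseq_SucD)
      then show "d j \<subseteq> d (Suc j)" by (force simp: d_def)
    qed
    show "isLub B (range d) s" unfolding isLub_set_iff
    proof (intro conjI ballI impI)
      show "s \<in> B" using lub by (simp add: isLub_set_iff)
      have "a n \<subseteq> s" for n using lub by (auto simp: isLub_set_iff)
      then show "c \<subseteq> s" if "c \<in> range d" for c using that b_sub by (fastforce simp: d_def)
      fix u assume u: "u \<in> B" "\<forall>c\<in>range d. c \<subseteq> u"
      have "a n \<subseteq> u" for n
      proof -
        have "b n j \<subseteq> u" for j
        proof -
          have "b n j \<subseteq> b n (max j (Suc n))" using incseqD[OF b(2)] by simp
          also have "\<dots> \<subseteq> d (max j (Suc n))" unfolding d_def by (intro UN_upper) auto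
          also have "\<dots> \<subseteq> u" using u(2) by blast
          finally show ?thesis .
        qed
        then show ?thesis using b(3)[of n] u(1) unfolding isLub_set_iff by blast
      qed
      then show "s \<subseteq> u" using lub u(1) unfolding isLub_set_iff by blast
    qed
    fix j
    have fin: "\<nu> (\<Union>n<k. b n j) = (\<Sum>n<k. \<nu> (b n j))" for k
    proof (induction k)
      case (Suc k)
      have "(\<Union>n<k. b n j) \<inter> b k j = {}"
      proof -
        have "b n j \<inter> b k j = {}" if "n < k" for n
          using disjoint_family_onD[OF disj, of n k] b_sub[of n j] b_sub[of k j] that by auto
        then show ?thesis by blast
      qed
      moreover have "(\<Union>n<k. b n j) \<in> B" using bB by (intro finite_UN) auto
      ultimately have "\<nu> ((\<Union>n<k. b n j) \<union> b k j) = \<nu> (\<Union>n<k. b n j) + \<nu> (b k j)"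
        using bB by (intro nu_add)
      then show ?case using Suc by (simp add: lessThan_Suc Un_commute add.commute)
    qed (simp add: nu_empty)
    have "\<nu> (d j) \<le> (\<Sum>n<j. sigma_part (a n) + \<epsilon> * (1/2) ^ Suc n)"
      unfolding d_def fin by (intro sum_mono b(4))
    also have "\<dots> = (\<Sum>n<j. sigma_part (a n)) + \<epsilon> * (\<Sum>n<j. (1/2) ^ Suc n)"
      by (simp add: sum.distrib sum_distrib_left)
    also have "(\<Sum>n<j. (1/2::real) ^ Suc n) = 1 - (1/2) ^ j" by (induction j) auto
    also have "(\<Sum>n<j. sigma_part (a n)) + \<epsilon> * (1 - (1/2) ^ j) \<le> M + \<epsilon>"
      using M[of j] \<epsilon> by (intro add_mono) (auto simp: mult_le_cancel_left1)
    finally show "\<nu> (d j) \<le> M + \<epsilon>" .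
  qed
  then show "sigma_part s \<le> M + \<epsilon>" by (rule sigma_part_le)
qed

lemma sigma_part_add:
  assumes ab: "a \<in> B" "b \<in> B" "a \<inter> b = {}"
  shows "sigma_part (a \<union> b) = sigma_part a + sigma_part b"
proof (rule antisym)
  \<comment> \<open>Padding with \<open>{}\<close> makes finite subadditivity a case of the
    countable one.\<close>
  define f where "f i = (if i = 0 then a else if i = 1 then b else {})" for i :: nat
  have f: "f 0 = a" "f (Suc 0) = b" "\<And>i. f (Suc (Suc i)) = {}" by (auto simp: f_def)
  show "sigma_part (a \<union> b) \<le> sigma_part a + sigma_part b"
  proof (rule sigma_part_subadd[of f])
    show "f n \<in> B" for n using ab by (simp add: f_def)
    show "disjoint_family f" using ab(3) by (auto simp: disjoint_family_on_def f_def)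
    show "isLub B (range f) (a \<union> b)" unfolding isLub_set_iff
    proof (intro conjI ballI impI)
      show "a \<union> b \<in> B" using ab by blast
      show "c \<subseteq> a \<union> b" if "c \<in> range f" for c using that by (auto simp: f_def split: if_splits)
      fix u assume "\<forall>c\<in>range f. c \<subseteq> u"
      then have "f 0 \<subseteq> u" "f (Suc 0) \<subseteq> u" by blast+
      then show "a \<union> b \<subseteq> u" by (simp add: f)
    qed
    fix n
    have "(\<Sum>i<Suc (Suc n). sigma_part (f i)) = sigma_part a + sigma_part b"
      by (simp only: sum.lessThan_Suc_shift f) (simp add: sigma_part_empty)
    moreover have "(\<Sum>i<n. sigma_part (f i)) \<le> (\<Sum>i<Suc (Suc n). sigma_part (f i))"
      using ab by (intro sum_mono2) (auto simp: f_def intro: sigma_part_nonneg)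
    ultimately show "(\<Sum>i<n. sigma_part (f i)) \<le> sigma_part a + sigma_part b" by simp
  qed
qed (rule sigma_part_superadd[OF ab])

lemma sigma_part_sums:
  fixes a :: "nat \<Rightarrow> 'a set"
  assumes a: "\<And>n. a n \<in> B" and disj: "disjoint_family a" and lub: "isLub B (range a) s"
  shows "(\<lambda>n. sigma_part (a n)) sums sigma_part s"
proof -
  have sB: "s \<in> B" and as: "a n \<subseteq> s" for n using lub by (auto simp: isLub_set_iff)
  have UB: "(\<Union>i<n. a i) \<in> B" for n using a by (intro finite_UN) auto
  have fin: "sigma_part (\<Union>i<n. a i) = (\<Sum>i<n. sigma_part (a i))" for n
  proof (induction n)
    case (Suc n)
    have "a i \<inter> a n = {}" if "i < n" for i
      using disjoint_family_onD[OF disj, of i n] that by simp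
    then have "(\<Union>i<n. a i) \<inter> a n = {}" by blast
    then have "sigma_part ((\<Union>i<n. a i) \<union> a n) = sigma_part (\<Union>i<n. a i) + sigma_part (a n)"
      by (rule sigma_part_add[OF UB a])
    then show ?case using Suc by (simp add: lessThan_Suc Un_commute add.commute)
  qed (simp add: sigma_part_empty)
  have le: "(\<Sum>i<n. sigma_part (a i)) \<le> sigma_part s" for n
    unfolding fin[symmetric] by (rule sigma_part_mono[OF UB sB]) (use as in blast)
  have nonneg: "0 \<le> sigma_part (a n)" for n by (rule sigma_part_nonneg[OF a])
  have summable: "summable (\<lambda>n. sigma_part (a n))"
    by (rule summableI_nonneg_bounded[OF nonneg le])
  have "sigma_part s \<le> (\<Sum>n. sigma_part (a n))"
    by (rule sigma_part_subadd[OF a disj lub]) (use summable nonneg in \<open>auto intro: sum_le_suminf\<close>)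
  moreover have "(\<Sum>n. sigma_part (a n)) \<le> sigma_part s"
    by (rule suminf_le_const[OF summable le])
  ultimately show ?thesis using summable_sums[OF summable] by simp
qed

text \<open>If the value were 0, exhaustions of \<open>a\<close> would give \<open>c k\<close> of
  charge at most \<open>1 / Suc k\<close> with \<open>a - c k\<close> in \<open>S k\<close>. These
  differences are null, with some majorant \<open>d\<close>. Some \<open>a - d k\<close> is nonzero,
  and it lies inside every \<open>c i\<close> with \<open>i \<ge> k\<close>, so its charge is 0,
  against strict positivity of \<open>\<nu>\<close>.\<close>

lemma sigma_part_pos:
  assumes a: "a \<in> B" "a \<noteq> {}"
  shows "0 < sigma_part a"
proof (rule ccontr)
  assume "\<not> ?thesis"
  then have zero: "Inf (exhaustion_bounds \<nu> a) = 0"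
    using sigma_part_nonneg[OF a(1)] by (simp add: sigma_part_def)
  have "\<exists>c. c \<in> B \<and> \<nu> c \<le> 1 / real (Suc k) \<and> a - c \<in> S k" for k
  proof -
    have "Inf (exhaustion_bounds \<nu> a) < 1 / real (Suc k)" by (simp add: zero)
    then obtain r where r: "r \<in> exhaustion_bounds \<nu> a" "r < 1 / real (Suc k)"
      using nu_in_exhaustion_bounds[OF a(1)] by (metis cInf_lessD empty_iff)
    then obtain b where b: "range b \<subseteq> B" "incseq b" "isLub B (range b) a" "\<forall>j. \<nu> (b j) \<le> r"
      unfolding exhaustion_bounds_def by (elim CollectE exE conjE)
    have "null_seq B (\<lambda>j. a - b j)" unfolding null_seq_def
    proof (intro exI[of _ "\<lambda>j. a - b j"] conjI ballI impI)
      show "range (\<lambda>j. a - b j) \<subseteq> B" using a b(1) by auto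
      show "decseq (\<lambda>j. a - b j)" using b(2) by (fastforce simp: incseq_def decseq_def)
      fix u assume u: "u \<in> B" "\<forall>j. u \<subseteq> a - b j"
      have "b j \<subseteq> a - u" for j
      proof -
        have "b j \<subseteq> a" using b(3) by (auto simp: isLub_set_iff)
        then show ?thesis using spec[OF u(2), of j] by blast
      qed
      moreover have "a - u \<in> B" using a u by blast
      ultimately have "a \<subseteq> a - u" using b(3) unfolding isLub_set_iff by blast
      then show "u = {}" using spec[OF u(2), of 0] by blast
    qed simp
    moreover have "range (\<lambda>j. a - b j) \<subseteq> B" using a b(1) by auto
    ultimately obtain j where "a - b j \<in> S k" using null_S[of "\<lambda>j. a - b j" k] by blast
    moreover have "\<nu> (b j) \<le> 1 / real (Suc k)" using spec[OF b(4), of j] r(2) by linarith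
    ultimately show ?thesis using b(1) by blast
  qed
  then obtain c where c: "\<And>k. c k \<in> B" "\<And>k. \<nu> (c k) \<le> 1 / real (Suc k)" "\<And>k. a - c k \<in> S k"
    by metis
  obtain d where d: "range d \<subseteq> B" "decseq d" "\<forall>k. a - c k \<subseteq> d k"
    "\<forall>u\<in>B. (\<forall>n. u \<subseteq> d n) \<longrightarrow> u = {}"
    by (rule null_seqE[OF S_null[of "\<lambda>k. a - c k", OF c(3)]])
  obtain k where k: "\<not> a \<subseteq> d k" using d(4) a by metis
  define u where "u = a - d k"
  have u: "u \<in> B" "u \<noteq> {}" using k a d(1) by (auto simp: u_def)
  have "\<nu> u \<le> 1 / real (Suc i)" if "i \<ge> k" for i
  proof -
    have "u \<subseteq> c i" using decseqD[OF d(2) that] spec[OF d(3), of i] by (auto simp: u_def)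
    then have "\<nu> u \<le> \<nu> (c i)" by (rule nu_mono[OF u(1) c(1)])
    then show ?thesis using c(2)[of i] by simp
  qed
  then have "\<nu> u \<le> 0"
    using LIMSEQ_inverse_real_of_nat
    by (intro LIMSEQ_le_const) (auto simp: inverse_eq_divide)
  then show False using nu_pos[OF u] by simp
qed

lemma is_measure_sigma_part: "is_measure X B (\<lambda>a. sigma_part a / sigma_part X)"
proof -
  have X: "0 < sigma_part X" using sigma_part_pos nonempty by blast
  have "(\<lambda>n. sigma_part (a n) / sigma_part X) sums (sigma_part (bsup B (range a)) / sigma_part X)"
    if "range a \<subseteq> B" "disjoint_family a" for a :: "nat \<Rightarrow> 'a set"
    using that by (intro sums_divide sigma_part_sums bsup_isLub) auto
  moreover have "sigma_part a / sigma_part X \<le> sigma_part b / sigma_part X"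
    if "a \<in> B" "b \<in> B" "a \<subseteq> b" for a b
    using that X by (intro divide_right_mono sigma_part_mono) auto
  moreover have "sigma_part (a \<union> b) / sigma_part X = sigma_part a / sigma_part X + sigma_part b / sigma_part X"
    if "a \<in> B" "b \<in> B" "a \<inter> b = {}" for a b
    by (simp only: sigma_part_add[OF that] add_divide_distrib)
  moreover have "0 < sigma_part a / sigma_part X" if "a \<in> B" "a \<noteq> {}" for a
    using sigma_part_pos[OF that] X by simp
  ultimately show ?thesis unfolding is_measure_def using X by (simp add: sigma_part_empty)
qed

end

end

section \<open>Uniform weak distributivity and measures\<close>

lemma partition_subset: "partition B W \<Longrightarrow> W \<subseteq> B"
  by (auto simp: partition_def antichain_def)

lemma null_seq_mono:
  assumes "null_seq B b" "\<And>n. a n \<subseteq> b n"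
  shows "null_seq B a"
proof -
  obtain d where "range d \<subseteq> B" "decseq d" "\<forall>n. b n \<subseteq> d n"
    "\<forall>u\<in>B. (\<forall>n. u \<subseteq> d n) \<longrightarrow> u = {}"
    by (rule null_seqE[OF assms(1)])
  moreover have "\<forall>n. a n \<subseteq> d n" using calculation(3) assms(2) by blast
  ultimately show ?thesis unfolding null_seq_def by (intro exI[of _ d] conjI)
qed

context sigma_complete_algebra
begin

text \<open>Nullity of choices from the \<open>S n\<close> is uniform weak distributivity for the
  partitions that witness membership. For the converse law, a majorant \<open>d\<close> yields the
  countable partition into its consecutive differences; \<open>F\<close> selects finitely many of
  them, and all late terms of the sequence miss these.\<close>

lemma ex_null_base:
  assumes "uniformly_weakly_distributive X B"
  obtains S where "null_base X B S"
proof -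
  obtain F :: "nat \<Rightarrow> 'a set set \<Rightarrow> 'a set set" where
    F_all: "\<forall>n\<ge>1. \<forall>W. partition B W \<longrightarrow> finite (F n W) \<and> F n W \<subseteq> W" and
    lim: "\<forall>W. (\<forall>n\<ge>1. partition B (W n) \<and> countable (W n)) \<longrightarrow> blim B (\<lambda>n. \<Union> (F n (W n))) X"
    using assms unfolding uniformly_weakly_distributive_def by (elim exE conjE)
  have F: "finite (F n W) \<and> F n W \<subseteq> W" if "n \<ge> 1" "partition B W" for n W
    using F_all that by simp
  define S where "S k = {a \<in> B. \<exists>W. partition B W \<and> countable W \<and> a \<inter> \<Union> (F (Suc k) W) = {}}" for k
  have FB: "\<Union> (F n W) \<in> B" if "n \<ge> 1" "partition B W" for n W
    using F[OF that] partition_subset[OF that(2)] by (intro finite_Union) auto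
  have "null_base X B S"
  proof unfold_locales
    show "S k \<subseteq> B" for k by (auto simp: S_def)
  next
    fix a assume a: "\<And>n. a n \<in> S n"
    then have "\<forall>n. \<exists>W. partition B W \<and> countable W \<and> a n \<inter> \<Union> (F (Suc n) W) = {}"
      by (simp add: S_def)
    then obtain W where W: "\<And>n. partition B (W n)" "\<And>n. countable (W n)"
      "\<And>n. a n \<inter> \<Union> (F (Suc n) (W n)) = {}" by metis
    \<comment> \<open>Index shift: \<open>F\<close> starts at 1 and \<open>S\<close> at 0, so
      \<open>F (Suc n)\<close> acts on \<open>W n\<close>.\<close>
    have "blim B (\<lambda>n. \<Union> (F n (W (n - 1)))) X"
      by (rule lim[rule_format]) (simp add: W)
    then have "null_seq B (\<lambda>n. X - \<Union> (F (Suc n) (W n)))"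
      by (subst (asm) blim_space_iff) (simp_all add: FB W)
    moreover have "a n \<subseteq> X - \<Union> (F (Suc n) (W n))" for n
    proof -
      have "a n \<subseteq> X" using a[of n] sets_into_space by (auto simp: S_def)
      then show ?thesis using W(3)[of n] by blast
    qed
    ultimately show "null_seq B a" by (rule null_seq_mono)
  next
    fix a and k :: nat assume aB: "range a \<subseteq> B" and "null_seq B a"
    then obtain d where d: "range d \<subseteq> B" "decseq d" "\<forall>n. a n \<subseteq> d n"
      and d0: "\<forall>u\<in>B. (\<forall>n. u \<subseteq> d n) \<longrightarrow> u = {}"
      by (elim null_seqE)
    \<comment> \<open>Prepending \<open>X\<close> gives the differences the supremum
      \<open>X\<close> instead of \<open>d 0\<close>.\<close>
    define D where "D n = (case n of 0 \<Rightarrow> X | Suc i \<Rightarrow> d i)" for n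
    have DB: "D n \<in> B" for n using d(1) by (auto simp: D_def split: nat.splits)
    have "D (Suc n) \<subseteq> D n" for n
      using decseq_SucD[OF d(2)] DB[of "Suc n"] sets_into_space by (auto simp: D_def split: nat.splits)
    then have dec: "decseq D" by (rule decseq_SucI)
    define W where "W = range (\<lambda>n. D n - D (Suc n)) - {{}}"
    have WB: "W \<subseteq> B" using DB by (auto simp: W_def)
    have disj: "(D i - D (Suc i)) \<inter> (D j - D (Suc j)) = {}" if "i < j" for i j
      using decseqD[OF dec, of "Suc i" j] that by auto
    have "antichain B W"
      unfolding antichain_def
    proof (intro conjI ballI impI)
      show "W \<subseteq> B - {{}}" using WB by (auto simp: W_def)
      fix v w assume vw: "v \<in> W" "w \<in> W" "v \<noteq> w"
      then obtain i j where ij: "v = D i - D (Suc i)" "w = D j - D (Suc j)" by (auto simp: W_def)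
      then have "i < j \<or> j < i" using vw(3) by (cases i j rule: linorder_cases) auto
      then show "v \<inter> w = {}" using disj[of i j] disj[of j i] unfolding ij by blast
    qed
    moreover have "isLub B W X"
      unfolding isLub_space_iff[OF algebra_axioms WB]
    proof (intro ballI impI)
      fix u assume u: "u \<in> B" "\<forall>w\<in>W. w \<subseteq> u"
      have step: "D n - D (Suc n) \<subseteq> u" for n
        using u(2) by (cases "D n - D (Suc n) = {}") (auto simp: W_def)
      have "X - u \<subseteq> D n" for n
      proof (induction n)
        case (Suc n)
        then show ?case using step[of n] by blast
      qed (simp add: D_def)
      from this[of "Suc _"] have "\<forall>n. X - u \<subseteq> d n" by (simp add: D_def)
      moreover have "X - u \<in> B" using u(1) by blast
      ultimately have "X - u = {}" using d0 by meson
      then show "X \<subseteq> u" by blast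
    qed
    ultimately have part: "partition B W" by (simp add: partition_iff_isLub[OF algebra_axioms])
    have cW: "countable W" by (simp add: W_def)
    have fin: "finite (F (Suc k) W)" "F (Suc k) W \<subseteq> W" using F[OF _ part, of "Suc k"] by auto
    then have "F (Suc k) W \<subseteq> range (\<lambda>n. D n - D (Suc n))" by (auto simp: W_def)
    from finite_subset_image[OF fin(1) this]
    obtain I where I: "finite I" "F (Suc k) W = (\<lambda>n. D n - D (Suc n)) ` I"
      by (elim exE conjE)
    obtain N where N: "I \<subseteq> {..<N}" using I(1) by (auto simp: finite_nat_iff_bounded)
    have "a n \<in> S k" if n: "n \<ge> N" for n
    proof -
      have an: "a n \<subseteq> D (Suc n)" using d(3) by (simp add: D_def)
      have "a n \<inter> (D i - D (Suc i)) = {}" if "i \<in> I" for i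
      proof -
        have "Suc i \<le> Suc n" using N n that by auto
        from decseqD[OF dec this] show ?thesis using an by blast
      qed
      then have "a n \<inter> \<Union> (F (Suc k) W) = {}" unfolding I(2) by blast
      moreover have "a n \<in> B" using aB by blast
      ultimately show ?thesis using part cW by (simp add: S_def) metis
    qed
    then show "\<exists>n0. \<forall>n\<ge>n0. a n \<in> S k" by blast
  qed
  then show thesis by (rule that)
qed

text \<open>A supremum in \<open>B\<close> need not be the union, but upper bounds see only the
  union. A sequence may therefore be replaced by its disjointed version.\<close>

lemma isLub_cong_UN:
  fixes a b :: "nat \<Rightarrow> 'a set"
  assumes "(\<Union>n. a n) = (\<Union>n. b n)"
  shows "isLub B (range a) s \<longleftrightarrow> isLub B (range b) s"
proof -
  have upper: "(\<forall>e\<in>range c. e \<subseteq> u) \<longleftrightarrow> (\<Union>n. c n) \<subseteq> u" for c :: "nat \<Rightarrow> 'a set" and u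
    by blast
  show ?thesis unfolding isLub_set_iff upper assms ..
qed

section \<open>Both conditions from a measure\<close>

context
  fixes m :: "'a set \<Rightarrow> real"
  assumes m: "is_measure X B m"
begin

lemma m_empty: "m {} = 0" and m_space: "m X = 1"
  using m by (simp_all add: is_measure_def)

lemma m_pos: "a \<in> B \<Longrightarrow> a \<noteq> {} \<Longrightarrow> 0 < m a"
  using m by (simp add: is_measure_def)

lemma m_mono: "a \<in> B \<Longrightarrow> b \<in> B \<Longrightarrow> a \<subseteq> b \<Longrightarrow> m a \<le> m b"
  using m by (simp add: is_measure_def)

lemma m_add: "a \<in> B \<Longrightarrow> b \<in> B \<Longrightarrow> a \<inter> b = {} \<Longrightarrow> m (a \<union> b) = m a + m b"
  using m by (simp add: is_measure_def)

lemma m_sums: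
  fixes f :: "nat \<Rightarrow> 'a set"
  shows "range f \<subseteq> B \<Longrightarrow> disjoint_family f \<Longrightarrow> (\<lambda>n. m (f n)) sums m (bsup B (range f))"
  using m by (simp add: is_measure_def)

lemma m_nonneg: "a \<in> B \<Longrightarrow> 0 \<le> m a"
  using m_mono[of "{}" a] m_empty by simp

lemma m_finite_Union:
  assumes "finite A" "antichain B A"
  shows "m (\<Union>A) = (\<Sum>a\<in>A. m a)"
  using assms
proof (induction A rule: finite_induct)
  case (insert a A)
  have A: "antichain B A" and a: "a \<in> B" and AB: "A \<subseteq> B"
    using insert.prems by (auto simp: antichain_def)
  have "a \<inter> b = {}" if "b \<in> A" for b
  proof -
    have "a \<noteq> b" using insert.hyps(2) that by blast
    then show ?thesis using insert.prems that by (simp add: antichain_def)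
  qed
  then have "a \<inter> \<Union>A = {}" by blast
  moreover have "\<Union>A \<in> B" using AB insert.hyps(1) by blast
  ultimately have "m (a \<union> \<Union>A) = m a + m (\<Union>A)" using a by (intro m_add)
  then show ?case using insert.IH[OF A] insert.hyps by simp
qed (simp add: m_empty)

text \<open>Disjointing the sequence keeps its supremum and does not increase the measure of any
  term.\<close>

lemma m_countably_subadditive:
  fixes a :: "nat \<Rightarrow> 'a set"
  assumes a: "range a \<subseteq> B" and summable: "summable (\<lambda>n. m (a n))"
  shows "m (bsup B (range a)) \<le> (\<Sum>n. m (a n))"
proof -
  have dB: "range (disjointed a) \<subseteq> B" by (rule range_disjointed_sets[OF a])
  have "isLub B (range (disjointed a)) (bsup B (range a))"
    using isLub_cong_UN[OF UN_disjointed_eq] bsup_isLub[OF a] by simp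
  then have eq: "bsup B (range (disjointed a)) = bsup B (range a)" by (rule bsup_eqI)
  have sums: "(\<lambda>n. m (disjointed a n)) sums m (bsup B (range a))"
    using m_sums[OF dB disjoint_family_disjointed] eq by simp
  have "m (disjointed a n) \<le> m (a n)" for n
    using a dB disjointed_subset[of a n] by (intro m_mono) auto
  then show ?thesis
    using suminf_le[OF _ sums_summable[OF sums] summable] sums_unique[OF sums] by simp
qed

text \<open>Borel-Cantelli: the suprema of the tails have measure at most
  \<open>2 * (1/2) ^ n\<close>, so an element below all of them has measure 0 and is empty by strict
  positivity.\<close>

lemma null_seq_if_measure_small:
  assumes a: "\<And>n. a n \<in> B" and small: "\<And>n. m (a n) \<le> (1/2) ^ n"
  shows "null_seq B a"
proof -
  have range: "range (\<lambda>k. a (n + k)) \<subseteq> B" "countable (range (\<lambda>k. a (n + k)))" for n using a by auto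
  define d where "d n = bsup B (range (\<lambda>k. a (n + k)))" for n
  have dB: "d n \<in> B" for n unfolding d_def by (rule bsup_in[OF range])
  have d_small: "m (d n) \<le> 2 * (1/2) ^ n" for n
  proof -
    have le: "m (a (n + k)) \<le> (1/2) ^ n * (1/2) ^ k" for k
      using small[of "n + k"] by (simp add: power_add)
    have geo: "summable (\<lambda>k. (1/2::real) ^ n * (1/2) ^ k)"
      by (intro summable_mult summable_geometric) simp
    have summable: "summable (\<lambda>k. m (a (n + k)))"
      by (rule summable_comparison_test'[OF geo]) (use le a m_nonneg in auto)
    have "m (d n) \<le> (\<Sum>k. m (a (n + k)))"
      unfolding d_def by (rule m_countably_subadditive[OF range(1) summable])
    also have "\<dots> \<le> (\<Sum>k. (1/2) ^ n * (1/2) ^ k)" by (rule suminf_le[OF le summable geo])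
    also have "\<dots> = (1/2) ^ n * (\<Sum>k. (1/2) ^ k)" by (intro suminf_mult summable_geometric) simp
    also have "\<dots> = 2 * (1/2) ^ n" by (simp add: suminf_geometric)
    finally show ?thesis .
  qed
  show ?thesis unfolding null_seq_def
  proof (intro exI[of _ d] conjI allI ballI impI)
    show "range d \<subseteq> B" using dB by blast
    show "decseq d"
    proof (rule decseq_SucI)
      fix n
      have "range (\<lambda>k. a (Suc n + k)) \<subseteq> range (\<lambda>k. a (n + k))"
        by (auto intro: range_eqI[of _ _ "Suc _"])
      then show "d (Suc n) \<subseteq> d n" unfolding d_def by (rule bsup_mono[OF _ range])
    qed
    fix n show "a n \<subseteq> d n" unfolding d_def
      by (rule bsup_upper[OF range]) (auto intro: range_eqI[of _ _ 0])
  next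
    fix u assume u: "u \<in> B" "\<forall>n. u \<subseteq> d n"
    have "m u \<le> 2 * (1/2) ^ n" for n
      using m_mono[OF u(1) dB[of n]] u(2) d_small[of n] by fastforce
    moreover have "(\<lambda>n. 2 * (1/2::real) ^ n) \<longlonglongrightarrow> 2 * 0"
      by (intro tendsto_mult_left LIMSEQ_power_zero) simp
    ultimately have "m u \<le> 2 * 0" by (intro LIMSEQ_le_const) blast+
    then show "u = {}" using m_pos[OF u(1)] by fastforce
  qed
qed

text \<open>At least \<open>2 ^ n\<close> disjoint elements have total measure at most 1, so one of
  them has measure at most \<open>(1/2) ^ n\<close>.\<close>

lemma measure_concentrated: "concentrated B"
  unfolding concentrated_def
proof (intro allI impI)
  fix A assume A: "\<forall>n\<ge>1. antichain B (A n) \<and> finite (A n) \<and> 2 ^ n \<le> card (A n)"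
  have "\<exists>a\<in>A n. m a \<le> (1/2) ^ n" if n: "n \<ge> 1" for n
  proof (rule ccontr)
    assume neg: "\<not> ?thesis"
    have An: "antichain B (A n)" "finite (A n)" "2 ^ n \<le> card (A n)" using A n by auto
    have ne: "A n \<noteq> {}" using An(3) by auto
    have "1 = (2::real) ^ n * (1/2) ^ n" by (simp add: power_mult_distrib[symmetric])
    also have "\<dots> \<le> real (card (A n)) * (1/2) ^ n"
      using An(3) by (intro mult_right_mono) (auto simp flip: of_nat_le_iff)
    also have "\<dots> = (\<Sum>a\<in>A n. (1/2) ^ n)" by simp
    also have "\<dots> < (\<Sum>a\<in>A n. m a)" using neg An(2) ne by (intro sum_strict_mono) auto
    also have "\<dots> = m (\<Union>(A n))" using m_finite_Union[OF An(2,1)] by simp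
    also have "\<dots> \<le> m X"
      using An by (intro m_mono) (auto simp: antichain_def dest: sets_into_space)
    finally show False by (simp add: m_space)
  qed
  then obtain a where a: "\<And>n. n \<ge> 1 \<Longrightarrow> a n \<in> A n" "\<And>n. n \<ge> 1 \<Longrightarrow> m (a n) \<le> (1/2) ^ n" by metis
  have aB: "a n \<in> B" if "n \<ge> 1" for n using A a(1)[OF that] that by (auto simp: antichain_def)
  have "m (a (Suc n)) \<le> (1/2) ^ n" for n
    using a(2)[of "Suc n"] m_nonneg[OF aB[of "Suc n"]] by simp
  then have "null_seq B (\<lambda>n. a (Suc n))" using aB by (intro null_seq_if_measure_small) auto
  then have "blim B a {}" using blim_empty_iff[of a] aB by simp
  then show "\<exists>a. (\<forall>n\<ge>1. a n \<in> A n) \<and> blim B a {}" using a(1) by blast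
qed

text \<open>The measures of the members of \<open>W\<close> sum to 1, so finitely many of them
  already exceed \<open>1 - \<epsilon>\<close>.\<close>

lemma countable_partition_approx:
  assumes W: "partition B W" "countable W" and \<epsilon>: "0 < \<epsilon>"
  shows "\<exists>E. finite E \<and> E \<subseteq> W \<and> m (X - \<Union>E) \<le> \<epsilon>"
proof -
  have anti: "antichain B W" and lub: "isLub B W X"
    using W(1) by (auto simp: partition_iff_isLub[OF algebra_axioms])
  have WB: "W \<subseteq> B" using anti by (auto simp: antichain_def)
  \<comment> \<open>At indices outside the image of \<open>to_nat_on W\<close>,
    \<open>from_nat_into\<close> would repeat members of \<open>W\<close>; the value
    \<open>{}\<close> keeps the enumeration disjoint, so finite and infinite \<open>W\<close> are
    treated alike.\<close>
  define e where "e n = (if n \<in> to_nat_on W ` W then from_nat_into W n else {})" for n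
  have e_in: "e n \<in> W \<or> e n = {}" for n using W(2) by (auto simp: e_def)
  have e_surj: "\<exists>n. w = e n" if "w \<in> W" for w
    using that W(2) by (intro exI[of _ "to_nat_on W w"]) (simp add: e_def)
  have eB: "range e \<subseteq> B" using e_in WB by (metis empty_sets image_subsetI subsetD)
  have "disjoint_family e" unfolding disjoint_family_on_def
  proof (intro ballI impI)
    fix i j :: nat assume "i \<noteq> j"
    show "e i \<inter> e j = {}"
    proof (cases "i \<in> to_nat_on W ` W \<and> j \<in> to_nat_on W ` W")
      case True
      then obtain v w where vw: "v \<in> W" "w \<in> W" "i = to_nat_on W v" "j = to_nat_on W w" by blast
      then have "e i = v" "e j = w" "v \<noteq> w" using W(2) \<open>i \<noteq> j\<close> by (auto simp: e_def)
      then show ?thesis using anti vw by (auto simp: antichain_def)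
    qed (auto simp: e_def)
  qed
  moreover have "isLub B (range e) X"
    unfolding isLub_space_iff[OF algebra_axioms eB]
  proof (intro ballI impI)
    fix u assume u: "u \<in> B" "\<forall>c\<in>range e. c \<subseteq> u"
    have "w \<subseteq> u" if w: "w \<in> W" for w
    proof -
      obtain n where "w = e n" using e_surj[OF w] by (elim exE)
      then show ?thesis using u(2) by simp
    qed
    then show "X \<subseteq> u" using lub u(1) by (simp add: isLub_space_iff[OF algebra_axioms WB])
  qed
  ultimately have "(\<lambda>n. m (e n)) sums 1" using m_sums[OF eB] by (simp add: bsup_eqI m_space)
  then have "(\<lambda>n. \<Sum>i<n. m (e i)) \<longlonglongrightarrow> 1" by (simp add: sums_def)
  then have "\<forall>\<^sub>F n in sequentially. 1 - \<epsilon> < (\<Sum>i<n. m (e i))"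
    by (rule order_tendstoD) (use \<epsilon> in simp)
  then obtain n where n: "1 - \<epsilon> < (\<Sum>i<n. m (e i))" by (auto simp: eventually_sequentially)
  define E where "E = e ` {..<n} - {{}}"
  have E: "finite E" "E \<subseteq> W" using e_in by (auto simp: E_def)
  have UE: "\<Union>E = (\<Union>i<n. e i)" by (auto simp: E_def)
  have UB: "(\<Union>i<k. e i) \<in> B" for k using eB by (intro finite_UN) auto
  have "m (\<Union>i<k. e i) = (\<Sum>i<k. m (e i))" for k
  proof (induction k)
    case (Suc k)
    have "e i \<inter> e k = {}" if "i < k" for i
      using disjoint_family_onD[OF \<open>disjoint_family e\<close>, of i k] that by simp
    then have "(\<Union>i<k. e i) \<inter> e k = {}" by blast
    then have "m ((\<Union>i<k. e i) \<union> e k) = m (\<Union>i<k. e i) + m (e k)"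
      using UB eB by (intro m_add) auto
    then show ?case using Suc by (simp add: lessThan_Suc Un_commute add.commute)
  qed (simp add: m_empty)
  then have "1 - \<epsilon> < m (\<Union>E)" using n by (simp add: UE)
  moreover have "m (\<Union>E \<union> (X - \<Union>E)) = m (\<Union>E) + m (X - \<Union>E)"
    using UB[of n] by (intro m_add) (auto simp: UE)
  moreover have "\<Union>E \<union> (X - \<Union>E) = X" using E(2) WB sets_into_space by blast
  ultimately have "m (X - \<Union>E) \<le> \<epsilon>" using m_space by simp
  then show ?thesis using E by blast
qed

lemma measure_uniformly_weakly_distributive: "uniformly_weakly_distributive X B"
proof -
  \<comment> \<open>The default \<open>{}\<close> makes \<open>F n W\<close> a finite subset of
    \<open>W\<close> for uncountable partitions as well.\<close>
  define F where "F n W = (if partition B W \<and> countable W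
    then SOME E. finite E \<and> E \<subseteq> W \<and> m (X - \<Union>E) \<le> (1/2) ^ n else {})" for n :: nat and W
  have F: "finite (F n W) \<and> F n W \<subseteq> W \<and> m (X - \<Union>(F n W)) \<le> (1/2) ^ n"
    if "partition B W" "countable W" for n W
    using someI_ex[OF countable_partition_approx[OF that, of "(1/2) ^ n"]] that
    by (simp add: F_def)
  show ?thesis unfolding uniformly_weakly_distributive_def
  proof (intro exI[of _ F] conjI allI impI)
    fix n :: nat and W assume "partition B W"
    then show "finite (F n W)" "F n W \<subseteq> W" using F[of W n] by (cases "countable W"; simp add: F_def)+
  next
    fix W assume W: "\<forall>n\<ge>1::nat. partition B (W n) \<and> countable (W n)"
    have B: "\<Union> (F n (W n)) \<in> B" if "n \<ge> 1" for n
      using F[of "W n" n] partition_subset[of B "W n"] W that by (intro finite_Union) auto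
    have "null_seq B (\<lambda>n. X - \<Union> (F (Suc n) (W (Suc n))))"
    proof (rule null_seq_if_measure_small)
      fix n
      show "X - \<Union> (F (Suc n) (W (Suc n))) \<in> B" using B[of "Suc n"] by auto
      have "m (X - \<Union> (F (Suc n) (W (Suc n)))) \<le> (1/2) ^ Suc n"
        using F[of "W (Suc n)" "Suc n"] spec[OF W, of "Suc n"] by (simp del: power_Suc)
      also have "\<dots> \<le> (1/2) ^ n" by simp
      finally show "m (X - \<Union> (F (Suc n) (W (Suc n)))) \<le> (1/2) ^ n" .
    qed
    then show "blim B (\<lambda>n. \<Union> (F n (W n))) X"
      using blim_space_iff[of "\<lambda>n. \<Union> (F n (W n))"] B by simp
  qed
qed

end

end

theorem theorem1p7:
  fixes X :: "'a set" and B :: "'a set set"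
  assumes "boolean_sigma_algebra X B"
  shows "measure_algebra X B \<longleftrightarrow> uniformly_weakly_distributive X B \<and> concentrated B"
proof -
  interpret algebra X B using assms by (simp add: boolean_sigma_algebra_def)
  interpret sigma_complete_algebra X B
    by unfold_locales (use assms in \<open>auto simp: boolean_sigma_algebra_def\<close>)
  show ?thesis
  proof
    assume "measure_algebra X B"
    then obtain m where "is_measure X B m" by (auto simp: measure_algebra_def)
    then show "uniformly_weakly_distributive X B \<and> concentrated B"
      using measure_uniformly_weakly_distributive measure_concentrated by blast
  next
    assume *: "uniformly_weakly_distributive X B \<and> concentrated B"
    then obtain S where "null_base X B S" using ex_null_base by blast
    then interpret null_base X B S .
    obtain \<nu> :: "'a set \<Rightarrow> real" where
      "\<And>a b. a \<in> B \<Longrightarrow> b \<in> B \<Longrightarrow> a \<inter> b = {} \<Longrightarrow> \<nu> (a \<union> b) = \<nu> a + \<nu> b"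
      "\<And>a. a \<in> B \<Longrightarrow> 0 \<le> \<nu> a" "\<And>a. a \<in> B \<Longrightarrow> a \<noteq> {} \<Longrightarrow> 0 < \<nu> a"
      using ex_strictly_positive_charge * by blast
    then have "is_measure X B (\<lambda>a. sigma_part \<nu> a / sigma_part \<nu> X)"
      by (rule is_measure_sigma_part)
    then show "measure_algebra X B" using assms by (auto simp: measure_algebra_def)
  qed
qed

end
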